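(* Let $X$ be either $\mathbb R^n$ or a fixed cube $Q\subset\mathbb R^n$, $n\ge1$, and let $\varphi\in\mathrm{BMO}(X)$ be non-constant (i.e., not a.e. equal to a constant). For $\varepsilon\in[0,\varepsilon_\varphi)$ let $F(\varepsilon)=[e^{\varepsilon\varphi}]_{A_\infty(X)}$. Then $F$ is a strictly increasing, continuous function on $[0,\varepsilon_\varphi)$, and $\lim_{\varepsilon\to\varepsilon_\varphi}F(\varepsilon)=\infty$.
   Context: For a cube $J\subset\mathbb R^n$, $\langle\varphi\rangle_J=\frac1{|J|}\int_J\varphi$. $\mathrm{BMO}(X)$ is the set of locally integrable $\varphi$ on $X$ with $\sup_{J\subset X}\langle|\varphi-\langle\varphi\rangle_J|\rangle_J<\infty$, the supremum being over all cubes $J\subset X$. An a.e. positive function $w$ is in $A_\infty(X)$ if $w$ and $\log w$ are locally integrable and $[w]_{A_\infty(X)}:=\sup_{J\subset X}\langle w\rangle_Je^{-\langle\log w\rangle_J}<\infty$, the supremum being over all cubes $J\subset X$. For $\varphi\in\mathrm{BMO}(X)$, $\varepsilon_\varphi=\sup\{\varepsilon>0:\ e^{\varepsilon\varphi}\in A_\infty(X)\}$, which is positive and may be $\infty$. *)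

theory Defs
  imports "HOL-Analysis.Analysis"
begin

text \<open>
  Cubes are closed, with sides parallel to the coordinate axes, and nondegenerate.
\<close>

definition cube :: "'a::euclidean_space set \<Rightarrow> bool" where
  "cube J \<longleftrightarrow> (\<exists>a l. 0 < l \<and> J = cbox a (a + l *\<^sub>R One))"

definition avg :: "'a::euclidean_space set \<Rightarrow> ('a \<Rightarrow> real) \<Rightarrow> real" where
  "avg J f = (LINT x:J|lebesgue. f x) / measure lebesgue J"

definition loc_integrable :: "'a::euclidean_space set \<Rightarrow> ('a \<Rightarrow> real) \<Rightarrow> bool" where
  "loc_integrable X f \<longleftrightarrow> (\<forall>K. compact K \<and> K \<subseteq> X \<longrightarrow> f absolutely_integrable_on K)"

definition bmo_seminorm :: "'a::euclidean_space set \<Rightarrow> ('a \<Rightarrow> real) \<Rightarrow> ereal" where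
  "bmo_seminorm X f = (SUP J\<in>{J. cube J \<and> J \<subseteq> X}. ereal (avg J (\<lambda>x. \<bar>f x - avg J f\<bar>)))"

definition BMO :: "'a::euclidean_space set \<Rightarrow> ('a \<Rightarrow> real) set" where
  "BMO X = {f. loc_integrable X f \<and> bmo_seminorm X f < \<infinity>}"

text \<open>
  The averages below are Bochner integrals, which are 0 for non-integrable functions, so
  the characteristic is meaningful only when \<open>w\<close> and its logarithm are locally integrable
  on \<open>X\<close>; the class \<open>A_infty X\<close> imposes this separately.
\<close>

definition A_infty_char :: "'a::euclidean_space set \<Rightarrow> ('a \<Rightarrow> real) \<Rightarrow> ereal" where
  "A_infty_char X w =
     (SUP J\<in>{J. cube J \<and> J \<subseteq> X}. ereal (avg J w * exp (- avg J (\<lambda>x. ln (w x)))))"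

definition A_infty :: "'a::euclidean_space set \<Rightarrow> ('a \<Rightarrow> real) set" where
  "A_infty X = {w. (AE x in lebesgue. x \<in> X \<longrightarrow> 0 < w x) \<and>
     loc_integrable X w \<and> loc_integrable X (\<lambda>x. ln (w x)) \<and> A_infty_char X w < \<infinity>}"

definition critical_exponent :: "'a::euclidean_space set \<Rightarrow> ('a \<Rightarrow> real) \<Rightarrow> ereal" where
  "critical_exponent X f =
     (SUP \<epsilon>\<in>{\<epsilon>::real. 0 < \<epsilon> \<and> (\<lambda>x. exp (\<epsilon> * f x)) \<in> A_infty X}. ereal \<epsilon>)"

end

theory Submission
  imports Defs
begin

text \<open>
  Write \<open>\<epsilon> \<mapsto> \<langle>exp (\<epsilon> (\<phi> - \<langle>\<phi>\<rangle>))\<rangle>\<close> for the ratio on a single cube. It is convex in \<open>\<epsilon>\<close>, at least \<open>1\<close>, and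
  equal to \<open>1\<close> for \<open>\<epsilon> > 0\<close> only if \<open>\<phi>\<close> is constant on the cube. So \<open>F\<close>, the supremum over all cubes, is
  convex with \<open>F 0 = 1\<close> and \<open>F \<epsilon> > 1\<close> for \<open>\<epsilon> > 0\<close>, which gives strict monotonicity, continuity, and
  blow-up when the critical exponent is infinite. When it is finite, blow-up follows from a reverse
  Hoelder inequality whose exponent \<open>p > 1\<close> depends only on a bound for \<open>F \<epsilon>\<close> and the dimension: if
  \<open>F\<close> stayed bounded, some \<open>p * \<epsilon>\<close> beyond the critical exponent would still be admissible. Should no
  positive exponent be admissible, the critical exponent is \<open>-\<infinity>\<close> and all claims are vacuous, so the
  John-Nirenberg inequality is not needed.
\<close>

subsection \<open>Dyadic decomposition of cubes\<close>

abbreviation cub :: "'a::euclidean_space \<Rightarrow> real \<Rightarrow> 'a set" where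
  "cub a l \<equiv> cbox a (a + l *\<^sub>R One)"

definition unit_vertices :: "'a::euclidean_space set" where
  "unit_vertices = (\<lambda>A. \<Sum>A) ` Pow Basis"

lemma finite_unit_vertices [simp]: "finite unit_vertices"
  by (simp add: unit_vertices_def)

lemma inner_sum_Basis:
  assumes "A \<subseteq> Basis" "i \<in> Basis"
  shows "\<Sum>A \<bullet> i = (if i \<in> A then 1 else 0)"
proof -
  have "finite A" using assms(1) finite_Basis finite_subset by blast
  have "\<Sum>A \<bullet> i = (\<Sum>j\<in>A. if j = i then 1 else 0)"
    unfolding inner_sum_left
    by (rule sum.cong) (use assms in \<open>auto simp: inner_Basis\<close>)
  then show ?thesis using \<open>finite A\<close> by simp
qed

lemma unit_vertices_inner:
  assumes "v \<in> unit_vertices" "i \<in> Basis"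
  shows "v \<bullet> i = 0 \<or> v \<bullet> i = 1"
  using assms by (auto simp: unit_vertices_def inner_sum_Basis)

lemma mem_cub: "x \<in> cub a l \<longleftrightarrow> (\<forall>i\<in>Basis. a \<bullet> i \<le> x \<bullet> i \<and> x \<bullet> i \<le> a \<bullet> i + l)"
  by (simp add: mem_box inner_add_left)

lemma cub_not_empty: "0 \<le> l \<Longrightarrow> a \<in> cub a l"
  by (simp add: mem_cub)

lemma child_subset:
  assumes "v \<in> unit_vertices" "0 \<le> l"
  shows "cub (a + (l/2) *\<^sub>R v) (l/2) \<subseteq> cub a l"
proof
  fix x assume x: "x \<in> cub (a + (l/2) *\<^sub>R v) (l/2)"
  show "x \<in> cub a l"
    unfolding mem_cub
  proof
    fix i :: 'a assume i: "i \<in> Basis"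
    have "a \<bullet> i + l/2 * (v \<bullet> i) \<le> x \<bullet> i \<and> x \<bullet> i \<le> a \<bullet> i + l/2 * (v \<bullet> i) + l/2"
      using x i unfolding mem_cub by (simp add: inner_add_left)
    then show "a \<bullet> i \<le> x \<bullet> i \<and> x \<bullet> i \<le> a \<bullet> i + l"
      using unit_vertices_inner[OF assms(1) i] assms(2) by auto
  qed
qed

lemma children_division:
  fixes a :: "'a::euclidean_space"
  assumes l: "0 < l"
  defines "Q \<equiv> \<lambda>v. cub (a + (l/2) *\<^sub>R v) (l/2)"
  shows "inj_on Q unit_vertices" "Q ` unit_vertices division_of cub a l"
proof -
  have disj: "interior (Q v) \<inter> interior (Q u) = {}"
    if uv: "v \<in> unit_vertices" "u \<in> unit_vertices" "v \<noteq> u" for u v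
  proof -
    obtain i where i: "i \<in> Basis" "v \<bullet> i \<noteq> u \<bullet> i"
      using uv(3) euclidean_eqI by blast
    have "v \<bullet> i = 0 \<and> u \<bullet> i = 1 \<or> v \<bullet> i = 1 \<and> u \<bullet> i = 0"
      using i unit_vertices_inner[OF uv(1) i(1)] unit_vertices_inner[OF uv(2) i(1)] by auto
    with i(1) l show ?thesis
      by (force simp: Q_def interior_cbox mem_box inner_add_left)
  qed
  have ne: "interior (Q v) \<noteq> {}" for v
    using l by (simp add: Q_def interior_cbox box_ne_empty inner_add_left)
  show "inj_on Q unit_vertices"
    by (rule inj_onI) (metis disj ne inf.idem)
  show "Q ` unit_vertices division_of cub a l"
  proof (rule division_ofI)
    show "\<Union>(Q ` unit_vertices) = cub a l"
    proof
      show "\<Union>(Q ` unit_vertices) \<subseteq> cub a l"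
        using child_subset[of _ l a] l by (auto simp: Q_def simp del: mem_box)
      show "cub a l \<subseteq> \<Union>(Q ` unit_vertices)"
      proof
        fix x assume x: "x \<in> cub a l"
        define A where "A = {i\<in>Basis. a \<bullet> i + l/2 \<le> x \<bullet> i}"
        have "\<Sum>A \<in> unit_vertices" by (auto simp: unit_vertices_def A_def)
        moreover have "x \<in> Q (\<Sum>A)"
          unfolding Q_def mem_cub
        proof
          fix i :: 'a assume i: "i \<in> Basis"
          have "a \<bullet> i \<le> x \<bullet> i \<and> x \<bullet> i \<le> a \<bullet> i + l" using x i mem_cub by blast
          moreover have "\<Sum>A \<bullet> i = (if a \<bullet> i + l/2 \<le> x \<bullet> i then 1 else 0)"
            using i by (subst inner_sum_Basis) (auto simp: A_def)
          ultimately show "(a + (l/2) *\<^sub>R \<Sum>A) \<bullet> i \<le> x \<bullet> i \<and> x \<bullet> i \<le> (a + (l/2) *\<^sub>R \<Sum>A) \<bullet> i + l/2"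
            by (auto simp: inner_add_left)
        qed
        ultimately show "x \<in> \<Union>(Q ` unit_vertices)" by blast
      qed
    qed
    show "finite (Q ` unit_vertices)" by simp
    fix K assume "K \<in> Q ` unit_vertices"
    then obtain v where v: "v \<in> unit_vertices" "K = Q v" by blast
    show "K \<subseteq> cub a l" using v child_subset[of v l a] l by (simp add: Q_def)
    show "K \<noteq> {}" using v ne[of v] interior_empty by force
    show "\<exists>c d. K = cbox c d" using v by (auto simp: Q_def)
  next
    fix K L assume "K \<in> Q ` unit_vertices" "L \<in> Q ` unit_vertices" "K \<noteq> L"
    then show "interior K \<inter> interior L = {}" using disj by blast
  qed
qed

lemma integral_children:
  fixes f :: "'a::euclidean_space \<Rightarrow> real"
  assumes "0 < l" "f integrable_on cub a l"
  shows "integral (cub a l) f = (\<Sum>v\<in>unit_vertices. integral (cub (a + (l/2) *\<^sub>R v) (l/2)) f)"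
  using integral_combine_division_topdown[OF assms(2) children_division(2)[OF assms(1)]]
  by (simp add: sum.reindex[OF children_division(1)[OF assms(1)]])

lemma measure_cub: "0 \<le> l \<Longrightarrow> measure lebesgue (cub (a::'a::euclidean_space) l) = l ^ DIM('a)"
  by (simp add: content_cbox inner_add_left)

fun dyadic_sum :: "nat \<Rightarrow> ('a::euclidean_space \<Rightarrow> real \<Rightarrow> real) \<Rightarrow> 'a \<Rightarrow> real \<Rightarrow> real" where
  "dyadic_sum 0 R a l = R a l"
| "dyadic_sum (Suc j) R a l = (\<Sum>v\<in>unit_vertices. dyadic_sum j R (a + (l/2) *\<^sub>R v) (l/2))"

lemma dyadic_sum_mono:
  assumes "\<And>b. cub b (l / 2^j) \<subseteq> cub a l \<Longrightarrow> R b (l / 2^j) \<le> R' b (l / 2^j)" "0 \<le> l"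
  shows "dyadic_sum j R a l \<le> dyadic_sum j R' a l"
  using assms
proof (induction j arbitrary: a l)
  case (Suc j)
  show ?case unfolding dyadic_sum.simps
  proof (intro sum_mono Suc.IH)
    fix v :: 'a and b assume v: "v \<in> unit_vertices"
      and b: "cub b (l/2/2^j) \<subseteq> cub (a + (l/2) *\<^sub>R v) (l/2)"
    have "cub b (l/2^Suc j) \<subseteq> cub a l"
      using b child_subset[OF v Suc.prems(2), of a] by (simp add: divide_divide_eq_left)
    from Suc.prems(1)[OF this] show "R b (l/2/2^j) \<le> R' b (l/2/2^j)"
      by (simp add: divide_divide_eq_left)
  qed (use Suc.prems in auto)
qed simp

lemma dyadic_sum_linear:
  "dyadic_sum j (\<lambda>b m. R b m + c * R' b m) a l = dyadic_sum j R a l + c * dyadic_sum j R' a l"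
  by (induction j arbitrary: a l) (simp_all add: sum.distrib sum_distrib_left)

lemma dyadic_sum_integral:
  assumes "0 < l" "f integrable_on cub a l"
  shows "dyadic_sum j (\<lambda>b m. integral (cub b m) f) a l = integral (cub a l) f"
  using assms
proof (induction j arbitrary: a l)
  case (Suc j)
  have "dyadic_sum (Suc j) (\<lambda>b m. integral (cub b m) f) a l
     = (\<Sum>v\<in>unit_vertices. integral (cub (a + (l/2) *\<^sub>R v) (l/2)) f)"
    unfolding dyadic_sum.simps
  proof (intro sum.cong refl Suc.IH)
    fix v :: 'a assume "v \<in> unit_vertices"
    then show "f integrable_on cub (a + (l/2) *\<^sub>R v) (l/2)"
      using Suc.prems child_subset[of v l a] integrable_on_subcbox by (metis less_imp_le)
  qed (use Suc.prems in auto)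
  then show ?case using integral_children[OF Suc.prems] by simp
qed simp

lemma continuous_L1_approx:
  fixes f :: "'a::euclidean_space \<Rightarrow> real"
  assumes f: "f \<in> borel_measurable (lebesgue_on (cbox a b))"
    and N: "\<And>x. x \<in> cbox a b \<Longrightarrow> \<bar>f x\<bar> \<le> N" and "0 < \<eta>"
  obtains g where "continuous_on (cbox a b) g" "integral (cbox a b) (\<lambda>x. \<bar>f x - g x\<bar>) < \<eta>"
proof -
  have "f measurable_on (cbox a b)"
    using f by (simp add: measurable_on_iff_borel_measurable)
  then obtain Z g where Z: "negligible Z" and g: "\<And>n. continuous_on UNIV (g n)"
    and lim: "\<And>x. x \<notin> Z \<Longrightarrow> (\<lambda>n. g n x) \<longlonglongrightarrow> (if x \<in> cbox a b then f x else 0)"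
    unfolding measurable_on_def by blast
  define h where "h n x = max (-N) (min N (g n x))" for n x
  have h_cont: "continuous_on UNIV (h n)" for n
    unfolding h_def by (intro continuous_intros g)
  have "(\<lambda>x. \<bar>f x - h n x\<bar>) integrable_on cbox a b" for n
  proof (rule measurable_bounded_by_integrable_imp_integrable)
    have "h n \<in> borel_measurable (lebesgue_on (cbox a b))"
      by (rule continuous_imp_measurable_on_sets_lebesgue)
        (auto intro: continuous_on_subset[OF h_cont])
    then show "(\<lambda>x. \<bar>f x - h n x\<bar>) \<in> borel_measurable (lebesgue_on (cbox a b))"
      using f by simp
    show "norm \<bar>f x - h n x\<bar> \<le> 2 * N" if "x \<in> cbox a b" for x
      using N[OF that] by (auto simp: h_def max_def min_def)
  qed auto
  then have int: "(\<lambda>x. \<bar>f x - h n x\<bar>) integrable_on (cbox a b - Z)" for n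
    by (rule integrable_spike_set) (auto intro: negligible_subset[OF Z])
  have int_eq: "integral (cbox a b - Z) F = integral (cbox a b) F" for F :: "'a \<Rightarrow> real"
    by (rule integral_spike_set) (auto intro: negligible_subset[OF Z])
  have "(\<lambda>n. integral (cbox a b - Z) (\<lambda>x. \<bar>f x - h n x\<bar>)) \<longlonglongrightarrow> integral (cbox a b - Z) (\<lambda>x. 0)"
  proof (rule dominated_convergence)
    have "(\<lambda>x::'a. 2 * N) integrable_on cbox a b" by auto
    then show "(\<lambda>x. 2 * N) integrable_on cbox a b - Z"
      by (rule integrable_spike_set) (auto intro: negligible_subset[OF Z])
    show "norm \<bar>f x - h n x\<bar> \<le> 2 * N" if "x \<in> cbox a b - Z" for x n
      using N[of x] that by (auto simp: h_def max_def min_def)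
    fix x assume x: "x \<in> cbox a b - Z"
    then have "(\<lambda>n. g n x) \<longlonglongrightarrow> f x" using lim[of x] by simp
    then have "(\<lambda>n. \<bar>f x - h n x\<bar>) \<longlonglongrightarrow> \<bar>f x - max (-N) (min N (f x))\<bar>"
      unfolding h_def by (intro tendsto_intros)
    moreover have "max (-N) (min N (f x)) = f x" using N[of x] x by auto
    ultimately show "(\<lambda>n. \<bar>f x - h n x\<bar>) \<longlonglongrightarrow> 0" by simp
  qed (rule int)
  then have "eventually (\<lambda>n. integral (cbox a b) (\<lambda>x. \<bar>f x - h n x\<bar>) < \<eta>) sequentially"
    unfolding int_eq using \<open>0 < \<eta>\<close> by (intro order_tendstoD(2)) auto
  then obtain n where "integral (cbox a b) (\<lambda>x. \<bar>f x - h n x\<bar>) < \<eta>"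
    using eventually_happens sequentially_bot by blast
  then show thesis using that[of "h n"] h_cont continuous_on_subset by blast
qed

definition mean :: "('a::euclidean_space \<Rightarrow> real) \<Rightarrow> 'a \<Rightarrow> real \<Rightarrow> real" where
  "mean f b m = integral (cub b m) f / m ^ DIM('a)"

lemma integral_cub_const: "0 \<le> m \<Longrightarrow> integral (cub (b::'a::euclidean_space) m) (\<lambda>x. c) = m ^ DIM('a) * (c::real)"
  by (simp add: content_cbox inner_add_left)

lemma oscillation_le:
  fixes f :: "'a::euclidean_space \<Rightarrow> real"
  assumes f: "f absolutely_integrable_on cub b m" and m: "0 < m"
  shows "integral (cub b m) (\<lambda>x. \<bar>f x - mean f b m\<bar>) \<le> 2 * integral (cub b m) (\<lambda>x. \<bar>f x - c\<bar>)"
proof -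
  have fc: "(\<lambda>x. f x - c) absolutely_integrable_on cub b m" for c
    by (intro set_integral_diff f) auto
  have i1: "(\<lambda>x. f x - c) integrable_on cub b m" "(\<lambda>x. \<bar>f x - c\<bar>) integrable_on cub b m" for c
    using fc[of c] unfolding absolutely_integrable_on_def by auto
  have fi: "f integrable_on cub b m" using f set_lebesgue_integral_eq_integral(1) by blast
  have "integral (cub b m) (\<lambda>x. f x - c) = integral (cub b m) f - m ^ DIM('a) * c"
    using fi m by (subst integral_diff) (auto simp: integral_cub_const less_imp_le simp del: integral_const)
  also have "\<dots> = m ^ DIM('a) * (mean f b m - c)"
    using m by (simp add: mean_def field_simps)
  finally have "m ^ DIM('a) * \<bar>mean f b m - c\<bar> = \<bar>integral (cub b m) (\<lambda>x. f x - c)\<bar>"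
    using m by (simp add: abs_mult)
  also have "\<dots> \<le> integral (cub b m) (\<lambda>x. \<bar>f x - c\<bar>)"
    using integral_norm_bound_integral[OF i1, of c c] by simp
  finally have 1: "m ^ DIM('a) * \<bar>mean f b m - c\<bar> \<le> integral (cub b m) (\<lambda>x. \<bar>f x - c\<bar>)" .
  have "integral (cub b m) (\<lambda>x. \<bar>f x - mean f b m\<bar>)
      \<le> integral (cub b m) (\<lambda>x. \<bar>f x - c\<bar> + \<bar>mean f b m - c\<bar>)"
    by (intro integral_le i1 integrable_add) auto
  also have "\<dots> = integral (cub b m) (\<lambda>x. \<bar>f x - c\<bar>) + m ^ DIM('a) * \<bar>mean f b m - c\<bar>"
    using m by (subst integral_add) (auto simp: i1 integral_cub_const simp del: integral_const)
  finally show ?thesis using 1 by linarith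
qed

lemma dist_cub_le:
  fixes x y :: "'a::euclidean_space"
  assumes "x \<in> cub b m" "y \<in> cub b m" 
  shows "dist x y \<le> m * DIM('a)"
proof -
  have "norm (x - y) \<le> (\<Sum>i\<in>Basis. \<bar>(x - y) \<bullet> i\<bar>)" by (rule norm_le_l1)
  also have "\<dots> \<le> (\<Sum>i\<in>(Basis::'a set). m)"
  proof (rule sum_mono)
    fix i :: 'a assume "i \<in> Basis"
    then have "b \<bullet> i \<le> x \<bullet> i \<and> x \<bullet> i \<le> b \<bullet> i + m" "b \<bullet> i \<le> y \<bullet> i \<and> y \<bullet> i \<le> b \<bullet> i + m"
      using assms unfolding mem_cub by blast+
    then show "\<bar>(x - y) \<bullet> i\<bar> \<le> m" unfolding inner_diff_left by arith
  qed
  finally show ?thesis by (simp add: dist_norm mult.commute)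
qed

lemma dyadic_oscillation_small:
  fixes f :: "'a::euclidean_space \<Rightarrow> real"
  assumes f: "f \<in> borel_measurable (lebesgue_on (cub a l))"
    and N: "\<And>x. x \<in> cub a l \<Longrightarrow> \<bar>f x\<bar> \<le> N" and l: "0 < l" and \<eta>: "0 < \<eta>"
  shows "\<exists>j. dyadic_sum j (\<lambda>b m. integral (cub b m) (\<lambda>x. \<bar>f x - mean f b m\<bar>)) a l < \<eta>"
proof -
  define V where "V = l ^ DIM('a)"
  have V: "0 < V" using l by (simp add: V_def)
  obtain g where g: "continuous_on (cub a l) g"
    and fg: "integral (cub a l) (\<lambda>x. \<bar>f x - g x\<bar>) < \<eta> / 4"
    using continuous_L1_approx[OF f N, of "\<eta>/4"] \<eta> by auto
  have uc: "uniformly_continuous_on (cub a l) g"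
    by (rule compact_uniformly_continuous[OF g]) simp
  have "0 < \<eta> / (4 * V)" using \<eta> V by simp
  then obtain d where d: "d > 0"
    "\<And>x y. x \<in> cub a l \<Longrightarrow> y \<in> cub a l \<Longrightarrow> dist x y < d \<Longrightarrow> dist (g x) (g y) < \<eta> / (4 * V)"
    by (rule uniformly_continuous_onE[OF uc]) (metis dist_commute)
  have "(\<lambda>j. l * DIM('a) * (1/2)^j) \<longlonglongrightarrow> l * DIM('a) * 0"
    by (intro tendsto_mult tendsto_const LIMSEQ_realpow_zero) auto
  then have "eventually (\<lambda>j. l * DIM('a) * (1/2)^j < d) sequentially"
    using d(1) by (intro order_tendstoD(2)) auto
  then obtain j where j: "l * DIM('a) * (1/2)^j < d"
    using eventually_happens sequentially_bot by blast
  have fint: "f absolutely_integrable_on cub a l"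
    by (rule measurable_bounded_by_integrable_imp_absolutely_integrable[OF f, of "\<lambda>x. N"]) (use N in auto)
  have gint: "g absolutely_integrable_on cub a l"
    using g by (rule absolutely_integrable_continuous)
  have fgi: "(\<lambda>x. \<bar>f x - g x\<bar>) integrable_on cub a l"
    by (intro set_lebesgue_integral_eq_integral(1) set_integrable_abs set_integral_diff fint gint)
  define G where "G x = 2 * \<bar>f x - g x\<bar> + 2 * (\<eta> / (4 * V))" for x
  have fgi2: "(\<lambda>x. 2 * \<bar>f x - g x\<bar>) integrable_on cub a l"
    using integrable_on_cmult_left[OF fgi, of 2] by simp
  then have Gi: "G integrable_on cub a l" unfolding G_def
    by (intro integrable_add) auto
  have "dyadic_sum j (\<lambda>b m. integral (cub b m) (\<lambda>x. \<bar>f x - mean f b m\<bar>)) a l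
     \<le> dyadic_sum j (\<lambda>b m. integral (cub b m) G) a l"
  proof (rule dyadic_sum_mono)
    fix b :: 'a assume b: "cub b (l / 2^j) \<subseteq> cub a l"
    define m where "m = l / 2^j"
    have m: "0 < m" using l by (simp add: m_def)
    have b': "cub b m \<subseteq> cub a l" using b by (simp add: m_def)
    have fi: "f absolutely_integrable_on cub b m"
      using fint b' set_integrable_subset by (metis lmeasurable_cbox fmeasurableD)
    have bin: "b \<in> cub b m" using m by (simp add: cub_not_empty less_imp_le)
    have gb: "\<bar>g x - g b\<bar> \<le> \<eta> / (4 * V)" if "x \<in> cub b m" for x
    proof -
      have "dist x b \<le> m * DIM('a)" using dist_cub_le[OF that bin] .
      also have "\<dots> < d" using j by (simp add: m_def power_one_over field_simps)
      finally show ?thesis using d(2)[of x b] that bin b' by (force simp: dist_real_def)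
    qed
    have "(\<lambda>x. f x - g b) absolutely_integrable_on cub b m"
      by (intro set_integral_diff fi) auto
    then have fbi: "(\<lambda>x. \<bar>f x - g b\<bar>) integrable_on cub b m"
      unfolding absolutely_integrable_on_def by simp
    have "integral (cub b m) (\<lambda>x. \<bar>f x - mean f b m\<bar>) \<le> 2 * integral (cub b m) (\<lambda>x. \<bar>f x - g b\<bar>)"
      by (rule oscillation_le[OF fi m])
    also have "\<dots> = integral (cub b m) (\<lambda>x. 2 * \<bar>f x - g b\<bar>)" by simp
    also have "\<dots> \<le> integral (cub b m) G"
    proof (rule integral_le)
      show "(\<lambda>x. 2 * \<bar>f x - g b\<bar>) integrable_on cub b m" using integrable_on_cmult_left[OF fbi, of 2] by simp
      show "G integrable_on cub b m" using Gi b' by (rule integrable_on_subcbox)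
      show "2 * \<bar>f x - g b\<bar> \<le> G x" if "x \<in> cub b m" for x
      proof -
        have "\<bar>f x - g b\<bar> \<le> \<bar>f x - g x\<bar> + \<bar>g x - g b\<bar>" by arith
        then have "\<bar>f x - g b\<bar> \<le> \<bar>f x - g x\<bar> + \<eta> / (4 * V)" using gb[OF that] by linarith
        then show ?thesis unfolding G_def by argo
      qed
    qed
    finally show "integral (cub b (l/2^j)) (\<lambda>x. \<bar>f x - mean f b (l/2^j)\<bar>) \<le> integral (cub b (l/2^j)) G"
      by (simp add: m_def)
  qed (use l in auto)
  also have "\<dots> = integral (cub a l) G" by (rule dyadic_sum_integral[OF l Gi])
  also have "\<dots> = 2 * integral (cub a l) (\<lambda>x. \<bar>f x - g x\<bar>) + V * (2 * (\<eta> / (4 * V)))"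
    unfolding G_def using l
    by (subst integral_add) (auto simp: fgi2 integral_cub_const V_def simp del: integral_const)
  also have "\<dots> < \<eta>" using fg V by simp
  finally show ?thesis by blast
qed

lemma nonneg_integral_zero_AE:
  fixes f :: "'a::euclidean_space \<Rightarrow> real"
  assumes f: "f integrable_on S" "\<And>x. x \<in> S \<Longrightarrow> 0 \<le> f x"
    and "integral S f \<le> 0"
  shows "AE x in lebesgue. x \<in> S \<longrightarrow> f x = 0"
proof -
  have ai: "f absolutely_integrable_on S" using f by (rule nonnegative_absolutely_integrable_1)
  have "(LINT x:S|lebesgue. f x) = 0"
    using set_lebesgue_integral_eq_integral(2)[OF ai] integral_nonneg[OF f] assms(3) by simp
  then have "AE x in lebesgue. indicator S x *\<^sub>R f x = 0"
    using ai f(2) unfolding set_integrable_def set_lebesgue_integral_def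
    by (subst (asm) integral_nonneg_eq_0_iff_AE) (auto simp: indicator_def)
  then show ?thesis by (auto simp: indicator_def)
qed

subsection \<open>Reverse Hoelder inequality\<close>

lemma powr_diff_le:
  fixes x c N \<delta> :: real
  assumes "0 \<le> x" "x \<le> N" "0 \<le> c" "0 < \<delta>"
  shows "x powr (1 + \<delta>) \<le> c powr (1 + \<delta>) + (1 + \<delta>) * N powr \<delta> * \<bar>x - c\<bar>"
proof (cases "x \<le> c")
  case True
  then have "x powr (1 + \<delta>) \<le> c powr (1 + \<delta>)" using assms by (intro powr_mono2) auto
  moreover have "0 \<le> (1 + \<delta>) * N powr \<delta> * \<bar>x - c\<bar>" using assms by simp
  ultimately show ?thesis by linarith
next
  case False
  then have cx: "c < x" by simp
  obtain z where z: "c < z" "z < x" "x powr (1 + \<delta>) - c powr (1 + \<delta>) = (\<lambda>h. (1 + \<delta>) * z powr \<delta> * h) (x - c)"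
  proof (rule mvt[OF cx, where f = "\<lambda>x. x powr (1 + \<delta>)" and f' = "\<lambda>z h. (1 + \<delta>) * z powr \<delta> * h"])
    show "continuous_on {c..x} (\<lambda>x. x powr (1 + \<delta>))"
      using assms by (intro continuous_on_powr' continuous_intros) auto
    fix z assume "c < z" "z < x"
    then have "((\<lambda>x. x powr (1 + \<delta>)) has_real_derivative (1 + \<delta>) * z powr (1 + \<delta> - 1)) (at z)"
      using assms by (intro has_real_derivative_powr) auto
    then show "((\<lambda>x. x powr (1 + \<delta>)) has_derivative (\<lambda>h. (1 + \<delta>) * z powr \<delta> * h)) (at z)"
      by (simp add: has_field_derivative_def)
  qed blast
  have "z powr \<delta> \<le> N powr \<delta>" using z assms by (intro powr_mono2) auto
  then have "(1 + \<delta>) * z powr \<delta> * (x - c) \<le> (1 + \<delta>) * N powr \<delta> * (x - c)"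
    using assms cx by (intro mult_right_mono mult_left_mono) auto
  then show ?thesis using z cx by simp
qed

locale positive_weight =
  fixes X :: "'a::euclidean_space set" and w :: "'a \<Rightarrow> real"
  assumes pos: "\<And>x. 0 < w x"
    and integrable_cub: "\<And>b m. 0 < m \<Longrightarrow> cub b m \<subseteq> X \<Longrightarrow> w absolutely_integrable_on cub b m"
begin

lemma integrable_sub:
  assumes "0 < m" "cub b m \<subseteq> X" "E \<in> sets lebesgue" "E \<subseteq> cub b m"
  shows "w integrable_on E"
  using set_integrable_subset[OF integrable_cub[OF assms(1,2)] assms(3,4)]
    set_lebesgue_integral_eq_integral(1) by blast

lemma integral_pos:
  assumes "0 < m" "cub b m \<subseteq> X"
  shows "0 < integral (cub b m) w"
proof -
  have i: "w integrable_on cub b m" using integrable_sub[OF assms] by simp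
  have "integral (cub b m) w \<noteq> 0"
  proof
    assume "integral (cub b m) w = 0"
    then have "AE x in lebesgue. x \<in> cub b m \<longrightarrow> w x = 0"
      by (intro nonneg_integral_zero_AE i) (auto simp: pos less_imp_le)
    then have "AE x in lebesgue. x \<notin> cub b m"
      by eventually_elim (use pos less_irrefl in metis)
    then have "measure lebesgue (cub b m) = 0"
      by (metis AE_iff_null_sets lmeasurable_cbox fmeasurableD measure_eq_0_null_sets)
    then show False using assms(1) by (simp add: measure_cub less_imp_le del: measure_completion)
  qed
  moreover have "0 \<le> integral (cub b m) w" by (rule integral_nonneg[OF i]) (simp add: pos less_imp_le)
  ultimately show ?thesis by simp
qed

lemma integral_mono_set:
  assumes "0 < m" "cub b m \<subseteq> X" "E \<in> sets lebesgue" "E' \<in> sets lebesgue" "E \<subseteq> E'" "E' \<subseteq> cub b m"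
  shows "integral E w \<le> integral E' w"
  by (rule integral_subset_le) (use assms pos in \<open>auto intro!: integrable_sub[OF assms(1,2)] simp: less_imp_le\<close>)

text \<open>
  A Calderon-Zygmund stopping argument by induction on the dyadic depth: \<open>E\<close> is the union of the
  maximal dyadic subcubes on which the mean of \<open>w\<close> exceeds \<open>t\<close>. A stopped cube still has mean at
  most \<open>2 ^ n * t\<close>, and the bound for smaller depth applies to it.
\<close>

lemma dyadic_stopping:
  fixes \<delta> S \<theta> :: real
  defines "R \<equiv> \<lambda>b m. integral (cub b m) w * mean w b m powr \<delta>"
  assumes \<delta>: "0 < \<delta>" and S: "0 \<le> S" "4 powr \<delta> + S * (4 * 2 ^ DIM('a)) powr \<delta> * \<theta> \<le> S"
    and H: "\<And>b m E. 0 < m \<Longrightarrow> cub b m \<subseteq> X \<Longrightarrow> E \<in> sets lebesgue \<Longrightarrow> E \<subseteq> cub b m \<Longrightarrow>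
      4 * measure lebesgue E \<le> m ^ DIM('a) \<Longrightarrow> integral E w \<le> \<theta> * integral (cub b m) w"
  shows "0 < m \<Longrightarrow> cub b m \<subseteq> X \<Longrightarrow> mean w b m \<le> t \<Longrightarrow>
    \<exists>E\<in>sets lebesgue. E \<subseteq> cub b m \<and> t * measure lebesgue E \<le> integral E w \<and>
      dyadic_sum j R b m \<le> t powr \<delta> * integral (cub b m) w + S * (2 ^ DIM('a) * t) powr \<delta> * integral E w"
    (is "_ \<Longrightarrow> _ \<Longrightarrow> _ \<Longrightarrow> \<exists>E\<in>_. ?A j b m t E")
    and "0 < m \<Longrightarrow> cub b m \<subseteq> X \<Longrightarrow> dyadic_sum j R b m \<le> S * R b m"
proof -
  define q where "q = DIM('a)"
  have mean_pos: "0 < mean w b m" if "0 < m" "cub b m \<subseteq> X" for b m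
    using integral_pos[OF that] that by (simp add: mean_def)
  have R_bound: "dyadic_sum j R b m \<le> S * R b m"
    if "0 < m" "cub b m \<subseteq> X" and A: "\<And>t. mean w b m \<le> t \<Longrightarrow> \<exists>E\<in>sets lebesgue. ?A j b m t E" for j b m
  proof -
    define \<mu> where "\<mu> = mean w b m"
    have \<mu>: "0 < \<mu>" using mean_pos that by (simp add: \<mu>_def)
    obtain E where E: "E \<in> sets lebesgue" "?A j b m (4 * \<mu>) E"
      using A[of "4 * \<mu>"] \<mu> unfolding \<mu>_def by auto
    let ?W = "integral (cub b m) w"
    have W: "?W = \<mu> * m ^ q" using that by (simp add: \<mu>_def mean_def q_def)
    have "4 * \<mu> * measure lebesgue E \<le> ?W"
      using E integral_mono_set[OF that(1,2) E(1), of "cub b m"] by fastforce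
    then have "\<mu> * (4 * measure lebesgue E) \<le> \<mu> * m ^ q" unfolding W by (simp add: mult_ac)
    then have "4 * measure lebesgue E \<le> m ^ q" using \<mu> mult_le_cancel_left_pos by blast
    then have \<theta>: "integral E w \<le> \<theta> * ?W" using H[OF that(1,2) E(1)] E(2) by (simp add: q_def)
    have "dyadic_sum j R b m \<le> (4 * \<mu>) powr \<delta> * ?W + S * (2 ^ q * (4 * \<mu>)) powr \<delta> * integral E w"
      using E(2) by (simp add: q_def)
    also have "\<dots> \<le> (4 * \<mu>) powr \<delta> * ?W + S * (2 ^ q * (4 * \<mu>)) powr \<delta> * (\<theta> * ?W)"
      using \<theta> S by (intro add_left_mono mult_left_mono) auto
    also have "\<dots> = (4 powr \<delta> + S * (4 * 2 ^ q) powr \<delta> * \<theta>) * (\<mu> powr \<delta> * ?W)"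
    proof -
      have "(2 ^ q * (4 * \<mu>)) powr \<delta> = (4 * 2 ^ q) powr \<delta> * \<mu> powr \<delta>"
        using \<mu> by (subst powr_mult[symmetric]) (auto simp: mult_ac)
      moreover have "(4 * \<mu>) powr \<delta> = 4 powr \<delta> * \<mu> powr \<delta>" using \<mu> by (simp add: powr_mult)
      ultimately show ?thesis by (simp add: algebra_simps)
    qed
    also have "\<dots> \<le> S * (\<mu> powr \<delta> * ?W)"
      using S integral_pos[OF that(1,2)] by (intro mult_right_mono) (auto simp: q_def)
    finally show ?thesis by (simp add: R_def \<mu>_def mult_ac)
  qed
  have main: "\<exists>E\<in>sets lebesgue. ?A j b m t E"
    if "0 < m" "cub b m \<subseteq> X" "mean w b m \<le> t" for j b m t
    using that
  proof (induction j arbitrary: b m t)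
    case 0
    have "mean w b m powr \<delta> \<le> t powr \<delta>"
      using 0 mean_pos[of m b] \<delta> by (intro powr_mono2) auto
    then have "R b m \<le> t powr \<delta> * integral (cub b m) w"
      using integral_pos[of m b] 0 by (simp add: R_def mult.commute)
    then show ?case by (intro bexI[of _ "{}"]) auto
  next
    case (Suc j)
    define Q where "Q v = cub (b + (m/2) *\<^sub>R v) (m/2)" for v
    have m2: "0 < m/2" using Suc by simp
    have Qb: "Q v \<subseteq> cub b m" if "v \<in> unit_vertices" for v
      unfolding Q_def using child_subset[OF that] Suc.prems by simp
    have QX: "Q v \<subseteq> X" if "v \<in> unit_vertices" for v
      using Qb[OF that] Suc.prems by simp
    have t: "0 < t" using mean_pos[of m b] Suc.prems by simp
    let ?D = "\<lambda>v. dyadic_sum j R (b + (m/2) *\<^sub>R v) (m/2)"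
    have "\<exists>E\<in>sets lebesgue. E \<subseteq> Q v \<and> t * measure lebesgue E \<le> integral E w \<and>
        ?D v \<le> t powr \<delta> * integral (Q v) w + S * (2 ^ q * t) powr \<delta> * integral E w"
      if v: "v \<in> unit_vertices" for v
    proof (cases "mean w (b + (m/2) *\<^sub>R v) (m/2) \<le> t")
      case True
      then show ?thesis using Suc.IH[OF m2 _ True] QX[OF v] by (simp add: Q_def q_def)
    next
      case False
      let ?\<mu> = "mean w (b + (m/2) *\<^sub>R v) (m/2)"
      have "?\<mu> = 2 ^ q * (integral (Q v) w / m ^ q)"
        by (simp add: mean_def Q_def q_def power_divide)
      also have "\<dots> \<le> 2 ^ q * (integral (cub b m) w / m ^ q)"
        using integral_mono_set[OF Suc.prems(1,2) _ _ Qb[OF v]] Suc.prems(1)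
        by (intro mult_left_mono divide_right_mono) (auto simp: Q_def)
      also have "\<dots> \<le> 2 ^ q * t"
        using Suc.prems(3) by (intro mult_left_mono) (auto simp: mean_def q_def)
      finally have \<mu>: "?\<mu> \<le> 2 ^ q * t" .
      have "?D v \<le> S * R (b + (m/2) *\<^sub>R v) (m/2)"
        using R_bound[OF m2] Suc.IH[OF m2] QX[OF v] by (simp add: Q_def)
      also have "\<dots> \<le> S * (integral (Q v) w * (2 ^ q * t) powr \<delta>)"
        unfolding R_def Q_def[symmetric]
        using S \<mu> mean_pos[OF m2] integral_pos[OF m2] QX[OF v] \<delta>
        by (intro mult_left_mono powr_mono2) (auto simp: Q_def less_imp_le)
      finally have 1: "?D v \<le> S * (2 ^ q * t) powr \<delta> * integral (Q v) w" by (simp add: mult_ac)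
      have "0 \<le> t powr \<delta> * integral (Q v) w"
        using integral_pos[OF m2] QX[OF v] by (simp add: Q_def less_imp_le)
      with 1 have "?D v \<le> t powr \<delta> * integral (Q v) w + S * (2 ^ q * t) powr \<delta> * integral (Q v) w"
        by linarith
      moreover have "t * measure lebesgue (Q v) \<le> integral (Q v) w"
        using False m2 Suc.prems(1) unfolding Q_def
        by (subst measure_cub) (auto simp: mean_def field_simps)
      ultimately show ?thesis by (intro bexI[of _ "Q v"]) (auto simp: Q_def)
    qed
    then obtain E where E: "\<And>v. v \<in> unit_vertices \<Longrightarrow> E v \<in> sets lebesgue"
      "\<And>v. v \<in> unit_vertices \<Longrightarrow> E v \<subseteq> Q v"
      "\<And>v. v \<in> unit_vertices \<Longrightarrow> t * measure lebesgue (E v) \<le> integral (E v) w"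
      "\<And>v. v \<in> unit_vertices \<Longrightarrow> ?D v \<le> t powr \<delta> * integral (Q v) w + S * (2 ^ q * t) powr \<delta> * integral (E v) w"
      by metis
    define U where "U = (\<Union>v\<in>unit_vertices. E v)"
    have U: "U \<in> sets lebesgue" "U \<subseteq> cub b m"
      unfolding U_def using E(1) E(2) Qb by (auto intro!: sets.finite_UN simp del: mem_box) blast
    have "(\<lambda>x. if x \<in> U then w x else 0) integrable_on cub b m"
      unfolding integrable_restrict_Int using integrable_sub[OF Suc.prems(1,2) U] U(2) by (simp add: inf.absorb1)
    from integral_children[OF Suc.prems(1) this]
    have "integral U w = (\<Sum>v\<in>unit_vertices. integral (U \<inter> Q v) w)"
      unfolding Henstock_Kurzweil_Integration.integral_restrict_Int Q_def[symmetric] using U(2) by (simp add: inf.absorb1)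
    also have "(\<Sum>v\<in>unit_vertices. integral (U \<inter> Q v) w) \<ge> (\<Sum>v\<in>unit_vertices. integral (E v) w)"
    proof (rule sum_mono)
      fix v :: 'a assume v: "v \<in> unit_vertices"
      show "integral (E v) w \<le> integral (U \<inter> Q v) w"
        by (rule integral_mono_set[OF Suc.prems(1,2)]) (use E v U in \<open>auto simp: Q_def U_def\<close>)
    qed
    finally have sumE: "(\<Sum>v\<in>unit_vertices. integral (E v) w) \<le> integral U w" .
    have "E v \<in> lmeasurable" if "v \<in> unit_vertices" for v
      using E(1,2)[OF that] by (metis Q_def bounded_set_imp_lmeasurable bounded_cbox bounded_subset)
    then have "measure lebesgue U \<le> (\<Sum>v\<in>unit_vertices. measure lebesgue (E v))"
      unfolding U_def by (intro measure_UNION_le) auto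
    then have "t * measure lebesgue U \<le> (\<Sum>v\<in>unit_vertices. t * measure lebesgue (E v))"
      using t by (simp flip: sum_distrib_left)
    also have "\<dots> \<le> (\<Sum>v\<in>unit_vertices. integral (E v) w)"
      by (intro sum_mono E)
    finally have measU: "t * measure lebesgue U \<le> integral U w" using sumE by linarith
    have "dyadic_sum (Suc j) R b m \<le>
        (\<Sum>v\<in>unit_vertices. t powr \<delta> * integral (Q v) w + S * (2 ^ q * t) powr \<delta> * integral (E v) w)"
      unfolding dyadic_sum.simps by (intro sum_mono E)
    also have "\<dots> = t powr \<delta> * (\<Sum>v\<in>unit_vertices. integral (Q v) w)
        + S * (2 ^ q * t) powr \<delta> * (\<Sum>v\<in>unit_vertices. integral (E v) w)"
      by (simp add: sum.distrib sum_distrib_left)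
    also have "(\<Sum>v\<in>unit_vertices. integral (Q v) w) = integral (cub b m) w"
      unfolding Q_def using integral_children[OF Suc.prems(1), of w b] integrable_sub[OF Suc.prems(1,2), of "cub b m"]
      by simp
    also have "S * (2 ^ q * t) powr \<delta> * (\<Sum>v\<in>unit_vertices. integral (E v) w)
       \<le> S * (2 ^ q * t) powr \<delta> * integral U w"
      using sumE S by (intro mult_left_mono) auto
    finally show ?case using U measU by (intro bexI[of _ U]) (auto simp: q_def)
  qed
  show "0 < m \<Longrightarrow> cub b m \<subseteq> X \<Longrightarrow> mean w b m \<le> t \<Longrightarrow> \<exists>E\<in>sets lebesgue. ?A j b m t E"
    by (rule main)
  show "0 < m \<Longrightarrow> cub b m \<subseteq> X \<Longrightarrow> dyadic_sum j R b m \<le> S * R b m"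
    by (rule R_bound) (auto intro: main)
qed

lemma truncated_reverse_holder:
  fixes \<delta> B :: real
  assumes am: "0 < l" "cub a l \<subseteq> X" and \<delta>: "0 < \<delta>"
    and B: "\<And>j. dyadic_sum j (\<lambda>b m. integral (cub b m) w * mean w b m powr \<delta>) a l \<le> B"
    and N: "0 < N"
  shows "(\<lambda>x. min (w x) N powr (1 + \<delta>)) integrable_on cub a l"
    "integral (cub a l) (\<lambda>x. min (w x) N powr (1 + \<delta>)) \<le> B"
proof -
  define f where "f x = min (w x) N" for x
  define K where "K = (1 + \<delta>) * N powr \<delta>"
  have K: "0 < K" using N \<delta> by (simp add: K_def)
  have f: "0 < f x" "f x \<le> N" "f x \<le> w x" for x using pos[of x] N by (auto simp: f_def)
  have wm: "w \<in> borel_measurable (lebesgue_on (cub a l))"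
    by (rule absolutely_integrable_imp_borel_measurable[OF integrable_cub[OF am]]) simp
  then have fm: "f \<in> borel_measurable (lebesgue_on (cub a l))"
    unfolding f_def by measurable
  have fp: "(\<lambda>x. f x powr (1 + \<delta>)) integrable_on cub a l"
  proof (rule measurable_bounded_by_integrable_imp_integrable[where g = "\<lambda>x. N powr (1 + \<delta>)"])
    show "(\<lambda>x. f x powr (1 + \<delta>)) \<in> borel_measurable (lebesgue_on (cub a l))"
      using fm by measurable
    show "norm (f x powr (1 + \<delta>)) \<le> N powr (1 + \<delta>)" for x
      using f[of x] \<delta> by (auto intro!: powr_mono2)
  qed auto
  then show "(\<lambda>x. min (w x) N powr (1 + \<delta>)) integrable_on cub a l" by (simp add: f_def)
  have fint: "f absolutely_integrable_on cub a l"
    by (rule measurable_bounded_by_integrable_imp_absolutely_integrable[OF fm, of "\<lambda>x. N"])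
      (use f in \<open>auto simp: less_imp_le\<close>)
  let ?R = "\<lambda>b m. integral (cub b m) w * mean w b m powr \<delta>"
  let ?O = "\<lambda>b m. integral (cub b m) (\<lambda>x. \<bar>f x - mean f b m\<bar>)"
  have local_bound: "integral (cub b m) (\<lambda>x. f x powr (1 + \<delta>)) \<le> ?R b m + K * ?O b m"
    if m: "0 < m" and sub: "cub b m \<subseteq> cub a l" for b m
  proof -
    define c where "c = mean f b m"
    have bX: "cub b m \<subseteq> X" using sub am by blast
    have V: "0 < m ^ DIM('a)" using m by simp
    have fi: "f absolutely_integrable_on cub b m"
      by (rule set_integrable_subset[OF fint _ sub]) simp
    then have fi': "f integrable_on cub b m" using set_lebesgue_integral_eq_integral(1) by blast
    have "(\<lambda>x. f x - c) absolutely_integrable_on cub b m"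
      by (intro set_integral_diff fi) auto
    then have oi: "(\<lambda>x. \<bar>f x - c\<bar>) integrable_on cub b m"
      unfolding absolutely_integrable_on_def by simp
    then have Koi: "(\<lambda>x. K * \<bar>f x - c\<bar>) integrable_on cub b m"
      using integrable_on_cmult_left[OF oi, of K] by simp
    have wi: "w integrable_on cub b m" using integrable_sub[OF m bX] by simp
    have c0: "0 \<le> c" unfolding c_def mean_def using V
      by (intro divide_nonneg_pos integral_nonneg fi') (auto simp: f(1) less_imp_le)
    have cw: "c \<le> mean w b m" unfolding c_def mean_def using V
      by (intro divide_right_mono integral_le fi' wi) (auto simp: f less_imp_le)
    have "integral (cub b m) (\<lambda>x. f x powr (1 + \<delta>)) \<le> integral (cub b m) (\<lambda>x. c powr (1 + \<delta>) + K * \<bar>f x - c\<bar>)"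
    proof (rule integral_le)
      show "(\<lambda>x. f x powr (1 + \<delta>)) integrable_on cub b m" using fp sub by (rule integrable_on_subcbox)
      show "f x powr (1 + \<delta>) \<le> c powr (1 + \<delta>) + K * \<bar>f x - c\<bar>" for x
        unfolding K_def using f[of x] c0 \<delta> by (intro powr_diff_le) auto
    qed (auto intro!: integrable_add Koi)
    also have "\<dots> = m ^ DIM('a) * c powr (1 + \<delta>) + K * integral (cub b m) (\<lambda>x. \<bar>f x - c\<bar>)"
      using m by (subst integral_add) (auto simp: Koi integral_cub_const simp del: integral_const)
    also have "c powr (1 + \<delta>) \<le> mean w b m powr (1 + \<delta>)"
      using c0 cw \<delta> by (intro powr_mono2) auto
    also have "m ^ DIM('a) * mean w b m powr (1 + \<delta>) = ?R b m"
      using integral_pos[OF m bX] V by (simp add: powr_add mean_def)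
    finally show ?thesis using V by (simp add: c_def)
  qed
  have "integral (cub a l) (\<lambda>x. f x powr (1 + \<delta>)) \<le> B + e" if "0 < e" for e
  proof -
    have "\<exists>j. dyadic_sum j ?O a l < e / K"
      by (rule dyadic_oscillation_small[OF fm _ am(1), of N]) (use f that K in \<open>auto simp: less_imp_le\<close>)
    then obtain j where j: "dyadic_sum j ?O a l < e / K" by blast
    have "integral (cub a l) (\<lambda>x. f x powr (1 + \<delta>))
        = dyadic_sum j (\<lambda>b m. integral (cub b m) (\<lambda>x. f x powr (1 + \<delta>))) a l"
      by (rule dyadic_sum_integral[OF am(1) fp, symmetric])
    also have "\<dots> \<le> dyadic_sum j (\<lambda>b m. ?R b m + K * ?O b m) a l"
      by (rule dyadic_sum_mono) (use local_bound am(1) in auto)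
    also have "\<dots> = dyadic_sum j ?R a l + K * dyadic_sum j ?O a l"
      by (rule dyadic_sum_linear)
    also have "\<dots> \<le> B + K * (e / K)"
      using B[of j] j K by (intro add_mono mult_left_mono) auto
    finally show ?thesis using K by simp
  qed
  then show "integral (cub a l) (\<lambda>x. min (w x) N powr (1 + \<delta>)) \<le> B"
    unfolding f_def by (rule field_le_epsilon)
qed

lemma reverse_holder:
  fixes \<delta> S \<theta> :: real
  assumes \<delta>: "0 < \<delta>" and S: "0 \<le> S" "4 powr \<delta> + S * (4 * 2 ^ DIM('a)) powr \<delta> * \<theta> \<le> S"
    and H: "\<And>b m E. 0 < m \<Longrightarrow> cub b m \<subseteq> X \<Longrightarrow> E \<in> sets lebesgue \<Longrightarrow> E \<subseteq> cub b m \<Longrightarrow>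
      4 * measure lebesgue E \<le> m ^ DIM('a) \<Longrightarrow> integral E w \<le> \<theta> * integral (cub b m) w"
    and am: "0 < l" "cub a l \<subseteq> X"
  shows "(\<lambda>x. w x powr (1 + \<delta>)) absolutely_integrable_on cub a l"
    "mean (\<lambda>x. w x powr (1 + \<delta>)) a l \<le> S * mean w a l powr (1 + \<delta>)"
proof -
  define B where "B = S * (integral (cub a l) w * mean w a l powr \<delta>)"
  have B: "dyadic_sum j (\<lambda>b m. integral (cub b m) w * mean w b m powr \<delta>) a l \<le> B" for j
    unfolding B_def by (rule dyadic_stopping(2)[OF \<delta> S _ am]) (rule H)
  define g where "g k x = min (w x) (real (Suc k)) powr (1 + \<delta>)" for k x
  have gi: "g k integrable_on cub a l" and gB: "integral (cub a l) (g k) \<le> B" for k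
    using truncated_reverse_holder[OF am \<delta> B, of "real (Suc k)"] unfolding g_def by auto
  have g0: "0 \<le> g k x" for k x by (simp add: g_def)
  have "(\<lambda>x. w x powr (1 + \<delta>)) integrable_on cub a l \<and>
    (\<lambda>k. integral (cub a l) (g k)) \<longlonglongrightarrow> integral (cub a l) (\<lambda>x. w x powr (1 + \<delta>))"
  proof (rule monotone_convergence_increasing)
    show "g k x \<le> g (Suc k) x" for k x
      unfolding g_def using pos[of x] \<delta> by (intro powr_mono2) auto
    show "(\<lambda>k. g k x) \<longlonglongrightarrow> w x powr (1 + \<delta>)" for x
    proof (rule tendsto_eventually)
      obtain n where "w x \<le> real n" using real_arch_simple by blast
      then have "g k x = w x powr (1 + \<delta>)" if "n \<le> k" for k
        using that by (simp add: g_def min_def)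
      then show "\<forall>\<^sub>F k in sequentially. g k x = w x powr (1 + \<delta>)"
        using eventually_sequentially by blast
    qed
    have "norm (integral (cub a l) (g k)) \<le> B" for k
      using gB[of k] integral_nonneg[OF gi g0] by simp
    then show "bounded (range (\<lambda>k. integral (cub a l) (g k)))"
      unfolding bounded_iff by blast
  qed (rule gi)
  then have i: "(\<lambda>x. w x powr (1 + \<delta>)) integrable_on cub a l"
    and lim: "(\<lambda>k. integral (cub a l) (g k)) \<longlonglongrightarrow> integral (cub a l) (\<lambda>x. w x powr (1 + \<delta>))"
    by auto
  show "(\<lambda>x. w x powr (1 + \<delta>)) absolutely_integrable_on cub a l"
    using i by (rule nonnegative_absolutely_integrable_1) simp
  have "integral (cub a l) (\<lambda>x. w x powr (1 + \<delta>)) \<le> B"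
    using lim gB by (intro LIMSEQ_le_const2) auto
  then have "mean (\<lambda>x. w x powr (1 + \<delta>)) a l \<le> B / l ^ DIM('a)"
    unfolding mean_def using am(1) by (intro divide_right_mono) auto
  also have "\<dots> = S * mean w a l powr (1 + \<delta>)"
    using integral_pos[OF am] am(1) by (simp add: B_def powr_add mean_def)
  finally show "mean (\<lambda>x. w x powr (1 + \<delta>)) a l \<le> S * mean w a l powr (1 + \<delta>)" .
qed

end

subsection \<open>The exponential ratio on a cube\<close>

definition exp_ratio :: "('a::euclidean_space \<Rightarrow> real) \<Rightarrow> 'a \<Rightarrow> real \<Rightarrow> real" where
  "exp_ratio \<psi> a l = mean (\<lambda>x. exp (\<psi> x)) a l * exp (- mean \<psi> a l)"

lemma mean_cmult: "mean (\<lambda>x. c * f x) a l = c * mean f a l"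
  by (simp add: mean_def)

lemma abs_integrable_cmult:
  fixes f :: "'a::euclidean_space \<Rightarrow> real"
  shows "f absolutely_integrable_on S \<Longrightarrow> (\<lambda>x. c * f x) absolutely_integrable_on S"
  by simp

lemma integral_centered:
  fixes f :: "'a::euclidean_space \<Rightarrow> real"
  assumes "0 < l" "f integrable_on cub a l"
  shows "integral (cub a l) (\<lambda>x. f x - mean f a l) = 0"
  using assms
  by (subst integral_diff) (auto simp: integral_cub_const less_imp_le mean_def simp del: integral_const)

lemma exp_tangent: "exp (s::real) * (1 + (t - s)) \<le> exp t"
proof -
  have "exp s * (1 + (t - s)) \<le> exp s * exp (t - s)"
    by (intro mult_left_mono exp_ge_add_one_self) auto
  then show ?thesis by (simp flip: exp_add)
qed

lemma exp_weight_absolutely_continuous: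
  fixes \<psi> :: "'a::euclidean_space \<Rightarrow> real"
  assumes l: "0 < l" and \<psi>: "\<psi> absolutely_integrable_on cub a l"
    and w: "(\<lambda>x. exp (\<psi> x)) absolutely_integrable_on cub a l"
    and M: "1 \<le> M" "exp_ratio \<psi> a l \<le> M"
    and E: "E \<in> sets lebesgue" "E \<subseteq> cub a l" "4 * measure lebesgue E \<le> l ^ DIM('a)"
  shows "integral E (\<lambda>x. exp (\<psi> x)) \<le> (1 - 3/4 * exp (- 2 * M) / M) * integral (cub a l) (\<lambda>x. exp (\<psi> x))"
proof -
  define Q where "Q = cub a l"
  define c where "c = mean \<psi> a l"
  define V where "V = l ^ DIM('a)"
  define g where "g x = \<psi> x - c" for x
  have V: "0 < V" using l by (simp add: V_def)
  have Em: "E \<in> lmeasurable" using E by (metis bounded_cbox bounded_set_imp_lmeasurable bounded_subset)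
  have gQ: "g absolutely_integrable_on Q"
    unfolding g_def Q_def by (intro set_integral_diff \<psi>) auto
  have eg: "exp (g x) = exp (- c) * exp (\<psi> x)" for x
    by (simp add: g_def exp_diff exp_minus field_simps)
  have egQ: "(\<lambda>x. exp (g x)) absolutely_integrable_on Q"
    unfolding eg Q_def by (rule abs_integrable_cmult[OF w])
  have on_E: "f integrable_on E" "f integrable_on Q"
    "integral (Q - E) f = integral Q f - integral E f" "f integrable_on (Q - E)"
    if f: "f absolutely_integrable_on Q" for f :: "'a \<Rightarrow> real"
  proof -
    have sub: "f integrable_on T" if "T \<in> sets lebesgue" "T \<subseteq> Q" for T
      using set_integrable_subset[OF f that] set_lebesgue_integral_eq_integral(1) by blast
    show "f integrable_on E" using sub E by (simp add: Q_def)
    show "f integrable_on Q" using sub[of Q] by (simp add: Q_def)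
    show "f integrable_on (Q - E)" using sub[of "Q - E"] E by (simp add: Q_def sets.Diff)
    show "integral (Q - E) f = integral Q f - integral E f"
      by (rule integral_setdiff) (use \<open>f integrable_on E\<close> \<open>f integrable_on Q\<close> E in \<open>auto simp: Q_def Diff_eq_empty_iff[THEN iffD2]\<close>)
  qed
  have "integral Q (\<lambda>x. exp (g x)) = exp (- c) * integral Q (\<lambda>x. exp (\<psi> x))"
    unfolding eg by simp
  also have "\<dots> = V * exp_ratio \<psi> a l"
    using V by (simp add: exp_ratio_def mean_def Q_def V_def c_def)
  finally have eV: "integral Q (\<lambda>x. exp (g x)) \<le> M * V" using M V by (simp add: mult.commute)
  have "integral Q g = 0"
    unfolding g_def Q_def c_def
    by (rule integral_centered[OF l]) (use \<psi> set_lebesgue_integral_eq_integral(1) in blast)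
  then have "integral (Q - E) g = - integral E g" using on_E(3)[OF gQ] by simp
  moreover have "integral E g \<le> integral E (\<lambda>x. exp (g x))"
  proof (rule integral_le[OF on_E(1)[OF gQ] on_E(1)[OF egQ]])
    show "g x \<le> exp (g x)" for x using exp_ge_add_one_self[of "g x"] by linarith
  qed
  moreover have "integral E (\<lambda>x. exp (g x)) \<le> integral Q (\<lambda>x. exp (g x))"
    by (rule integral_subset_le) (use on_E[OF egQ] E in \<open>auto simp: Q_def\<close>)
  ultimately have gB: "- (M * V) \<le> integral (Q - E) g" using eV by linarith
  have "(\<lambda>x. 1::real) absolutely_integrable_on Q" unfolding Q_def by auto
  note one = on_E[OF this]
  have "integral (Q - E) (\<lambda>x. 1) = V - measure lebesgue E"
    using one(3) lmeasure_integral[OF Em] l by (simp add: Q_def V_def integral_cub_const less_imp_le del: integral_const)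
  then have "3/4 * V \<le> integral (Q - E) (\<lambda>x. 1)" using E(3) by (simp add: V_def)
  then have mB: "(1 + 2 * M) * (3/4 * V) \<le> (1 + 2 * M) * integral (Q - E) (\<lambda>x. 1)"
    using M by (intro mult_left_mono) auto
  have ki: "(\<lambda>x. (1 + 2 * M) * 1) integrable_on (Q - E)"
    using integrable_on_cmult_left[OF one(4), of "1 + 2 * M"] by simp
  have gi: "(\<lambda>x. exp (- (2 * M)) * ((1 + 2 * M) * 1 + g x)) integrable_on (Q - E)"
    using integrable_on_cmult_left[OF integrable_add[OF ki on_E(4)[OF gQ]], of "exp (- (2 * M))"] by simp
  have "3/4 * V \<le> (1 + 2 * M) * (3/4 * V) - M * V"
    using M V by (simp add: algebra_simps)
  also have "\<dots> \<le> (1 + 2 * M) * integral (Q - E) (\<lambda>x. 1) + integral (Q - E) g"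
    using gB mB by linarith
  finally have "exp (- (2 * M)) * (3/4 * V)
      \<le> exp (- (2 * M)) * ((1 + 2 * M) * integral (Q - E) (\<lambda>x. 1) + integral (Q - E) g)"
    by (intro mult_left_mono) auto
  also have "\<dots> = integral (Q - E) (\<lambda>x. exp (- (2 * M)) * ((1 + 2 * M) * 1 + g x))"
    by (simp only: integral_mult_right integral_add[OF ki on_E(4)[OF gQ]])
  also have "\<dots> \<le> integral (Q - E) (\<lambda>x. exp (g x))"
  proof (rule integral_le[OF gi on_E(4)[OF egQ]])
    show "exp (- (2 * M)) * ((1 + 2 * M) * 1 + g x) \<le> exp (g x)" for x
      using exp_tangent[of "- (2 * M)" "g x"] by (simp add: algebra_simps)
  qed
  finally have low: "exp (- (2 * M)) * (3/4 * V) \<le> integral (Q - E) (\<lambda>x. exp (g x))" .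
  define \<kappa> where "\<kappa> = 3/4 * exp (- 2 * M) / M"
  have "\<kappa> * integral Q (\<lambda>x. exp (g x)) \<le> \<kappa> * (M * V)"
    using eV M by (intro mult_left_mono) (auto simp: \<kappa>_def)
  also have "\<dots> = exp (- (2 * M)) * (3/4 * V)" using M by (simp add: \<kappa>_def)
  finally have "\<kappa> * integral Q (\<lambda>x. exp (g x)) \<le> integral (Q - E) (\<lambda>x. exp (g x))" using low by linarith
  then have "integral E (\<lambda>x. exp (g x)) \<le> (1 - \<kappa>) * integral Q (\<lambda>x. exp (g x))"
    using on_E(3)[OF egQ] by (simp add: algebra_simps)
  then have "exp (- c) * integral E (\<lambda>x. exp (\<psi> x)) \<le> exp (- c) * ((1 - \<kappa>) * integral Q (\<lambda>x. exp (\<psi> x)))"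
    unfolding eg by (simp add: mult.left_commute)
  then show ?thesis by (simp add: \<kappa>_def Q_def)
qed

lemma exp_ratio_self_improvement:
  fixes X :: "'a::euclidean_space set"
  assumes M: "1 \<le> M"
  obtains p C where "1 < p"
    "\<And>\<psi> a l. (\<And>b m. 0 < m \<Longrightarrow> cub b m \<subseteq> X \<Longrightarrow> \<psi> absolutely_integrable_on cub b m \<and>
        (\<lambda>x. exp (\<psi> x)) absolutely_integrable_on cub b m \<and> exp_ratio \<psi> b m \<le> M) \<Longrightarrow>
      0 < l \<Longrightarrow> cub a l \<subseteq> X \<Longrightarrow>
      (\<lambda>x. exp (p * \<psi> x)) absolutely_integrable_on cub a l \<and> exp_ratio (\<lambda>x. p * \<psi> x) a l \<le> C"
proof -
  define \<theta> where "\<theta> = 1 - 3/4 * exp (- 2 * M) / M"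
  define K :: real where "K = 4 * 2 ^ DIM('a)"
  define \<delta> where "\<delta> = ln ((1 + \<theta>) / (2 * \<theta>)) / ln K"
  define S where "S = 4 powr \<delta> * 2 / (1 - \<theta>)"
  have "0 < 3/4 * exp (- 2 * M) / M" using M by simp
  moreover have "3/4 * exp (- 2 * M) / M \<le> 3/4"
  proof -
    have "exp (- 2 * M) \<le> 1" using M by simp
    then have "exp (- 2 * M) \<le> M" using M by linarith
    then show ?thesis using M by (simp add: divide_le_eq)
  qed
  ultimately have \<theta>: "0 < \<theta>" "\<theta> < 1" by (auto simp: \<theta>_def)
  have K: "1 < K" using one_le_power[of "2::real" "DIM('a)"] unfolding K_def by linarith
  have \<delta>: "0 < \<delta>" using \<theta> K by (auto simp: \<delta>_def)
  have "K powr \<delta> = (1 + \<theta>) / (2 * \<theta>)"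
    using K \<theta> by (simp add: powr_def \<delta>_def)
  then have K\<theta>: "K powr \<delta> * \<theta> = (1 + \<theta>) / 2" using \<theta> by simp
  have S0: "0 \<le> S" using \<theta> by (simp add: S_def)
  have "4 powr \<delta> = S * (1 - \<theta>) / 2" using \<theta> by (simp add: S_def)
  then have S: "4 powr \<delta> + S * (4 * 2 ^ DIM('a)) powr \<delta> * \<theta> \<le> S"
  proof -
    have "S * (4 * 2 ^ DIM('a)) powr \<delta> * \<theta> = S * ((1 + \<theta>) / 2)"
      by (simp only: mult.assoc K\<theta>[unfolded K_def mult.assoc])
    then show ?thesis using \<open>4 powr \<delta> = _\<close> by (simp add: field_simps)
  qed
  show thesis
  proof (rule that[of "1 + \<delta>" "S * M powr (1 + \<delta>)"])
    show "1 < 1 + \<delta>" using \<delta> by simp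
    fix \<psi> :: "'a \<Rightarrow> real" and a :: 'a and l :: real
    assume A: "\<And>b m. 0 < m \<Longrightarrow> cub b m \<subseteq> X \<Longrightarrow> \<psi> absolutely_integrable_on cub b m \<and>
        (\<lambda>x. exp (\<psi> x)) absolutely_integrable_on cub b m \<and> exp_ratio \<psi> b m \<le> M"
      and al: "0 < l" "cub a l \<subseteq> X"
    interpret positive_weight X "\<lambda>x. exp (\<psi> x)"
      by standard (use A in auto)
    have H: "integral E (\<lambda>x. exp (\<psi> x)) \<le> \<theta> * integral (cub b m) (\<lambda>x. exp (\<psi> x))"
      if "0 < m" "cub b m \<subseteq> X" "E \<in> sets lebesgue" "E \<subseteq> cub b m" "4 * measure lebesgue E \<le> m ^ DIM('a)"
      for b m E
      unfolding \<theta>_def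
      by (rule exp_weight_absolutely_continuous[OF that(1) _ _ M _ that(3-5)]) (use A[OF that(1,2)] in auto)
    have pw: "exp (\<psi> x) powr (1 + \<delta>) = exp ((1 + \<delta>) * \<psi> x)" for x
      by (simp add: exp_powr_real mult.commute)
    have rh: "(\<lambda>x. exp ((1 + \<delta>) * \<psi> x)) absolutely_integrable_on cub a l"
      "mean (\<lambda>x. exp ((1 + \<delta>) * \<psi> x)) a l \<le> S * mean (\<lambda>x. exp (\<psi> x)) a l powr (1 + \<delta>)"
      unfolding pw[symmetric]
      by (rule reverse_holder[OF \<delta> S0 S _ al], erule (4) H)+
    have mp: "0 \<le> mean (\<lambda>x. exp (\<psi> x)) a l"
      using integral_pos[OF al] al by (simp add: mean_def less_imp_le)
    have "exp_ratio (\<lambda>x. (1 + \<delta>) * \<psi> x) a l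
      \<le> S * mean (\<lambda>x. exp (\<psi> x)) a l powr (1 + \<delta>) * exp (- ((1 + \<delta>) * mean \<psi> a l))"
      unfolding exp_ratio_def mean_cmult using rh(2) by (intro mult_right_mono) auto
    also have "exp (- ((1 + \<delta>) * mean \<psi> a l)) = exp (- mean \<psi> a l) powr (1 + \<delta>)"
      by (simp add: exp_powr_real mult.commute)
    also have "S * mean (\<lambda>x. exp (\<psi> x)) a l powr (1 + \<delta>) * exp (- mean \<psi> a l) powr (1 + \<delta>)
      = S * exp_ratio \<psi> a l powr (1 + \<delta>)"
      using mp by (simp add: exp_ratio_def powr_mult mult.assoc)
    also have "\<dots> \<le> S * M powr (1 + \<delta>)"
      using S0 \<delta> A[OF al] mp by (intro mult_left_mono powr_mono2) (auto simp: exp_ratio_def)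
    finally show "(\<lambda>x. exp ((1 + \<delta>) * \<psi> x)) absolutely_integrable_on cub a l \<and>
      exp_ratio (\<lambda>x. (1 + \<delta>) * \<psi> x) a l \<le> S * M powr (1 + \<delta>)" using rh(1) by blast
  qed
qed

lemma exp_ratio_eq:
  "exp_ratio (\<lambda>x. t * f x) a l = mean (\<lambda>x. exp (t * (f x - mean f a l))) a l"
proof -
  have "exp (t * (f x - mean f a l)) = exp (- (t * mean f a l)) * exp (t * f x)" for x
    by (simp add: right_diff_distrib exp_diff exp_minus field_simps)
  then show ?thesis by (simp only: exp_ratio_def mean_cmult) (simp add: mult.commute)
qed

lemma exp_ratio_convex:
  fixes f :: "'a::euclidean_space \<Rightarrow> real"
  assumes l: "0 < l" and f: "f absolutely_integrable_on cub a l"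
    and s: "(\<lambda>x. exp (s * f x)) absolutely_integrable_on cub a l"
    and t: "(\<lambda>x. exp (t * f x)) absolutely_integrable_on cub a l"
    and u: "0 \<le> u" "0 \<le> v" "u + v = 1"
  shows "(\<lambda>x. exp ((u * s + v * t) * f x)) absolutely_integrable_on cub a l"
    "exp_ratio (\<lambda>x. (u * s + v * t) * f x) a l \<le> u * exp_ratio (\<lambda>x. s * f x) a l + v * exp_ratio (\<lambda>x. t * f x) a l"
proof -
  have cv: "exp ((u * s + v * t) * y) \<le> u * exp (s * y) + v * exp (t * y)" for y :: real
  proof -
    have u': "u = 1 - v" using u by simp
    have "exp ((1 - v) *\<^sub>R (s * y) + v *\<^sub>R (t * y)) \<le> (1 - v) * exp (s * y) + v * exp (t * y)"
      by (rule convex_onD[OF exp_convex]) (use u in auto)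
    moreover have "(u * s + v * t) * y = (1 - v) *\<^sub>R (s * y) + v *\<^sub>R (t * y)"
      by (simp add: u' algebra_simps)
    ultimately show ?thesis by (simp only: u')
  qed
  have fm: "f \<in> borel_measurable (lebesgue_on (cub a l))"
    by (rule absolutely_integrable_imp_borel_measurable[OF f]) simp
  have us: "(\<lambda>x. u * exp (s * f x)) absolutely_integrable_on cub a l"
    and vt: "(\<lambda>x. v * exp (t * f x)) absolutely_integrable_on cub a l"
    using s t by (auto intro: abs_integrable_cmult)
  show ai: "(\<lambda>x. exp ((u * s + v * t) * f x)) absolutely_integrable_on cub a l"
  proof (rule measurable_bounded_by_integrable_imp_absolutely_integrable)
    show "(\<lambda>x. exp ((u * s + v * t) * f x)) \<in> borel_measurable (lebesgue_on (cub a l))"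
      using fm by measurable
    show "(\<lambda>x. u * exp (s * f x) + v * exp (t * f x)) integrable_on cub a l"
      using us vt set_lebesgue_integral_eq_integral(1) by (intro integrable_add) blast+
    show "norm (exp ((u * s + v * t) * f x)) \<le> u * exp (s * f x) + v * exp (t * f x)" for x
      using cv[of "f x"] by simp
  qed simp
  define c where "c = mean f a l"
  have sh: "(\<lambda>x. exp (r * (f x - c))) integrable_on cub a l"
    if "(\<lambda>x. exp (r * f x)) absolutely_integrable_on cub a l" for r
  proof -
    have "exp (r * (f x - c)) = exp (- (r * c)) * exp (r * f x)" for x
      by (simp add: right_diff_distrib exp_diff exp_minus field_simps)
    then show ?thesis
      using set_lebesgue_integral_eq_integral(1)[OF abs_integrable_cmult[OF that]] by simp
  qed
  have us': "(\<lambda>x. u * exp (s * (f x - c))) integrable_on cub a l"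
    and vt': "(\<lambda>x. v * exp (t * (f x - c))) integrable_on cub a l"
    using integrable_on_cmult_left[OF sh[OF s], of u] integrable_on_cmult_left[OF sh[OF t], of v] by auto
  have "integral (cub a l) (\<lambda>x. exp ((u * s + v * t) * (f x - c)))
     \<le> integral (cub a l) (\<lambda>x. u * exp (s * (f x - c)) + v * exp (t * (f x - c)))"
    by (intro integral_le sh[OF ai] integrable_add us' vt' cv)
  also have "\<dots> = u * integral (cub a l) (\<lambda>x. exp (s * (f x - c))) + v * integral (cub a l) (\<lambda>x. exp (t * (f x - c)))"
    using integral_add[OF us' vt'] by simp
  finally show "exp_ratio (\<lambda>x. (u * s + v * t) * f x) a l \<le> u * exp_ratio (\<lambda>x. s * f x) a l + v * exp_ratio (\<lambda>x. t * f x) a l"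
    unfolding exp_ratio_eq c_def[symmetric]
    unfolding mean_def using l divide_right_mono[of _ _ "l ^ DIM('a)"] by (fastforce simp: add_divide_distrib)
qed

lemma exp_ratio_ge_1:
  fixes f :: "'a::euclidean_space \<Rightarrow> real"
  assumes l: "0 < l" and f: "f absolutely_integrable_on cub a l"
    and e: "(\<lambda>x. exp (f x)) absolutely_integrable_on cub a l"
  shows "1 \<le> exp_ratio f a l"
    and "exp_ratio f a l \<le> 1 \<Longrightarrow> AE x in lebesgue. x \<in> cub a l \<longrightarrow> f x = mean f a l"
proof -
  define c where "c = mean f a l"
  define h where "h x = exp (f x - c) - (1 + (f x - c))" for x
  have h0: "0 \<le> h x" for x using exp_ge_add_one_self[of "f x - c"] by (simp add: h_def)
  have "exp (f x - c) = exp (- c) * exp (f x)" for x by (simp add: exp_diff exp_minus field_simps)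
  then have i1: "(\<lambda>x. exp (f x - c)) integrable_on cub a l"
    using set_lebesgue_integral_eq_integral(1)[OF abs_integrable_cmult[OF e]] by simp
  have fi: "f integrable_on cub a l" using f set_lebesgue_integral_eq_integral(1) by blast
  have i2: "(\<lambda>x. f x - c) integrable_on cub a l" using fi by (intro integrable_diff) auto
  have i3: "(\<lambda>x. 1 + (f x - c)) integrable_on cub a l" using i2 by (intro integrable_add) auto
  have hi: "h integrable_on cub a l" unfolding h_def by (rule integrable_diff[OF i1 i3])
  have V: "0 < l ^ DIM('a)" using l by simp
  have "integral (cub a l) (\<lambda>x. 1 + (f x - c)) = l ^ DIM('a)"
    using integral_add[OF integrable_const i2, of 1] integral_centered[OF l fi] l
    by (simp add: c_def integral_cub_const less_imp_le del: integral_const)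
  then have "integral (cub a l) h = l ^ DIM('a) * exp_ratio f a l - l ^ DIM('a)"
    unfolding h_def using integral_diff[OF i1 i3] exp_ratio_eq[of 1 f a l] V
    by (simp add: c_def mean_def)
  then have ih: "integral (cub a l) h = l ^ DIM('a) * (exp_ratio f a l - 1)" by (simp add: algebra_simps)
  have "0 \<le> integral (cub a l) h" by (rule integral_nonneg[OF hi h0])
  then show "1 \<le> exp_ratio f a l" unfolding ih using V by (simp add: zero_le_mult_iff)
  assume "exp_ratio f a l \<le> 1"
  then have "integral (cub a l) h \<le> 0" unfolding ih using V by (simp add: mult_le_0_iff)
  then have "AE x in lebesgue. x \<in> cub a l \<longrightarrow> h x = 0" by (rule nonneg_integral_zero_AE[OF hi h0])
  moreover have "f x = c" if "h x = 0" for x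
    using that exp_minus_greater[of "c - f x"] by (auto simp: h_def)
  ultimately show "AE x in lebesgue. x \<in> cub a l \<longrightarrow> f x = mean f a l"
    unfolding c_def[symmetric] by (auto elim: eventually_mono)
qed

lemma cube_iff: "cube J \<longleftrightarrow> (\<exists>a l. 0 < l \<and> J = cub a l)"
  by (simp add: cube_def)

lemma mem_centered_cub: "x \<in> cub (- (r *\<^sub>R One)) (2 * r) \<longleftrightarrow> (\<forall>i\<in>Basis. \<bar>x \<bullet> i\<bar> \<le> r)"
  unfolding mem_cub by (rule ball_cong) (auto simp: abs_le_iff)

lemma mem_centered_cub_norm: "norm x \<le> r \<Longrightarrow> x \<in> cub (- (r *\<^sub>R One)) (2 * r)"
  unfolding mem_centered_cub using Basis_le_norm order_trans by blast

lemma compact_subset_cub: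
  fixes X :: "'a::euclidean_space set"
  assumes X: "X = UNIV \<or> cube X" and K: "compact K" "K \<subseteq> X"
  obtains a l where "0 < l" "K \<subseteq> cub a l" "cub a l \<subseteq> X"
  using X
proof
  assume "X = UNIV"
  obtain r where r: "0 < r" "\<And>x. x \<in> K \<Longrightarrow> norm x \<le> r"
    using compact_imp_bounded[OF K(1)] unfolding bounded_pos by blast
  then have "K \<subseteq> cub (- (r *\<^sub>R One)) (2 * r)" using mem_centered_cub_norm by blast
  then show thesis using that[of "2 * r" "- (r *\<^sub>R One)"] r(1) \<open>X = UNIV\<close> by simp
next
  assume "cube X"
  then show thesis using that K(2) unfolding cube_iff by blast
qed

lemma loc_integrable_iff:
  fixes X :: "'a::euclidean_space set"
  assumes X: "X = UNIV \<or> cube X"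
  shows "loc_integrable X f \<longleftrightarrow> (\<forall>a l. 0 < l \<longrightarrow> cub a l \<subseteq> X \<longrightarrow> f absolutely_integrable_on cub a l)"
    (is "_ \<longleftrightarrow> ?R")
proof
  assume "loc_integrable X f"
  then show ?R by (simp add: loc_integrable_def compact_cbox)
next
  assume R: ?R
  show "loc_integrable X f"
    unfolding loc_integrable_def
  proof (intro allI impI)
    fix K assume K: "compact K \<and> K \<subseteq> X"
    then obtain a l where "0 < l" "K \<subseteq> cub a l" "cub a l \<subseteq> X"
      using compact_subset_cub[OF X] by metis
    moreover have "K \<in> sets lebesgue" using K by (simp add: lmeasurable_compact fmeasurableD)
    ultimately show "f absolutely_integrable_on K" using R set_integrable_subset by metis
  qed
qed

lemma avg_cub:
  assumes "0 < l" "f absolutely_integrable_on cub a l"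
  shows "avg (cub a l) f = mean f a l"
  unfolding avg_def mean_def set_lebesgue_integral_eq_integral(2)[OF assms(2)]
  using assms(1) by (simp add: measure_cub less_imp_le del: measure_completion)

lemma A_infty_char_exp:
  assumes "\<And>a l. 0 < l \<Longrightarrow> cub a l \<subseteq> X \<Longrightarrow> f absolutely_integrable_on cub a l"
    and "\<And>a l. 0 < l \<Longrightarrow> cub a l \<subseteq> X \<Longrightarrow> (\<lambda>x. exp (f x)) absolutely_integrable_on cub a l"
  shows "A_infty_char X (\<lambda>x. exp (f x)) = (SUP (a, l)\<in>{(a, l). 0 < l \<and> cub a l \<subseteq> X}. ereal (exp_ratio f a l))"
proof -
  have "{J. cube J \<and> J \<subseteq> X} = (\<lambda>(a, l). cub a l) ` {(a, l). 0 < l \<and> cub a l \<subseteq> X}"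
    unfolding cube_iff by auto
  then show ?thesis
    unfolding A_infty_char_def
    by (auto simp: image_image exp_ratio_def avg_cub assms intro!: SUP_cong)
qed

lemma AE_constant_if_cubs:
  fixes X :: "'a::euclidean_space set"
  assumes X: "X = UNIV \<or> cube X"
    and c: "\<And>a l. 0 < l \<Longrightarrow> cub a l \<subseteq> X \<Longrightarrow> AE x in lebesgue. x \<in> cub a l \<longrightarrow> f x = (c a l :: real)"
  shows "\<exists>k. AE x in lebesgue. x \<in> X \<longrightarrow> f x = k"
  using X
proof
  assume "cube X"
  then show ?thesis using c unfolding cube_iff by blast
next
  assume XU: "X = UNIV"
  define Q :: "nat \<Rightarrow> 'a set" where "Q n = cub (- (real (Suc n) *\<^sub>R One)) (2 * real (Suc n))" for n
  define k where "k n = c (- (real (Suc n) *\<^sub>R One)) (2 * real (Suc n))" for n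
  have Q: "AE x in lebesgue. x \<in> Q n \<longrightarrow> f x = k n" for n
    unfolding Q_def k_def by (rule c) (simp_all add: XU)
  have sub: "Q 0 \<subseteq> Q n" for n
    unfolding Q_def subset_iff mem_centered_cub by fastforce
  have "k n = k 0" for n
  proof (rule ccontr)
    assume "k n \<noteq> k 0"
    have "AE x in lebesgue. x \<notin> Q 0"
      using Q[of n] Q[of 0] by eventually_elim (use \<open>k n \<noteq> k 0\<close> sub in auto)
    then have "measure lebesgue (Q 0) = 0"
      unfolding Q_def by (metis AE_iff_null_sets lmeasurable_cbox fmeasurableD measure_eq_0_null_sets)
    then show False unfolding Q_def by (subst (asm) measure_cub) auto
  qed
  then have "AE x in lebesgue. \<forall>n. x \<in> Q n \<longrightarrow> f x = k 0"
    using Q unfolding AE_all_countable by metis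
  moreover have "\<exists>n. x \<in> Q n" for x
  proof -
    obtain n where n: "norm x \<le> real n" using real_arch_simple by blast
    have "x \<in> Q n" unfolding Q_def by (rule mem_centered_cub_norm) (use n in simp)
    then show ?thesis ..
  qed
  ultimately show ?thesis by (auto elim: eventually_mono)
qed

lemma convex_family_blowup:
  fixes P :: "real \<Rightarrow> bool" and f :: "real \<Rightarrow> real" and b :: ereal
  assumes P0: "P 0" and f0: "f 0 = 1"
    and cP: "\<And>s t u v. P s \<Longrightarrow> P t \<Longrightarrow> 0 \<le> u \<Longrightarrow> 0 \<le> v \<Longrightarrow> u + v = 1 \<Longrightarrow> P (u * s + v * t)"
    and cf: "\<And>s t u v. P s \<Longrightarrow> P t \<Longrightarrow> 0 \<le> u \<Longrightarrow> 0 \<le> v \<Longrightarrow> u + v = 1 \<Longrightarrow>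
      f (u * s + v * t) \<le> u * f s + v * f t"
    and gt1: "\<And>t. 0 < t \<Longrightarrow> P t \<Longrightarrow> 1 < f t"
    and self: "\<And>M. 1 \<le> M \<Longrightarrow> \<exists>p>1. \<forall>t. P t \<longrightarrow> f t \<le> M \<longrightarrow> P (p * t)"
    and b: "b = (SUP \<epsilon>\<in>{\<epsilon>. 0 < \<epsilon> \<and> P \<epsilon>}. ereal \<epsilon>)"
    and I: "I = {\<epsilon>. 0 \<le> \<epsilon> \<and> ereal \<epsilon> < b}"
  shows "\<forall>\<epsilon>\<in>I. P \<epsilon>" "strict_mono_on I f" "continuous_on I f" "I \<noteq> {} \<Longrightarrow> \<exists>\<epsilon>\<in>I. r < f \<epsilon>"
proof -
  have above: "\<exists>t. 0 < t \<and> P t \<and> x < t" if x: "x \<in> I" for x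
    using x unfolding I b less_SUP_iff by auto
  have chord: "P x \<and> f x \<le> 1 + x / t * (f t - 1)" if "0 \<le> x" "x \<le> t" "0 < t" "P t" for x t
  proof -
    have "0 \<le> 1 - x / t" "0 \<le> x / t" "(1 - x / t) * 0 + x / t * t = x" using that by auto
    then show ?thesis
      using cP[OF P0 that(4), of "1 - x / t" "x / t"] cf[OF P0 that(4), of "1 - x / t" "x / t"]
      by (simp add: f0 algebra_simps)
  qed
  show PI: "\<forall>\<epsilon>\<in>I. P \<epsilon>"
  proof
    fix x assume x: "x \<in> I"
    then obtain t where "0 < t" "P t" "x < t" using above by blast
    then show "P x" using chord[of x t] x by (simp add: I)
  qed
  show smono: "strict_mono_on I f"
  proof (rule strict_mono_onI)
    fix x t assume xt: "x \<in> I" "t \<in> I" "x < t"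
    then have t: "0 \<le> x" "0 < t" "P t" using PI by (auto simp: I)
    then have "f x \<le> 1 + x / t * (f t - 1)" using chord[of x t] xt by simp
    also have "\<dots> < 1 + 1 * (f t - 1)"
      using gt1[OF t(2,3)] t xt by (intro add_strict_left_mono mult_strict_right_mono) auto
    finally show "f x < f t" by simp
  qed
  have f_ge: "1 \<le> f x" if "x \<in> I" for x
    using that gt1[of x] PI f0 by (cases "x = 0") (auto simp: I less_imp_le)
  define I' where "I' = {\<epsilon>. 0 < \<epsilon> \<and> ereal \<epsilon> < b}"
  have "I' = {0<..} \<inter> ereal -` {..<b}" by (auto simp: I'_def)
  then have oI: "open I'" by (auto intro!: open_Int open_ereal_vimage)
  have "convex I'"
    unfolding is_interval_convex_1[symmetric] is_interval_1 I'_def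
    by (auto intro: less_le_trans le_less_trans simp: ereal_less_eq(3)[symmetric] simp del: ereal_less_eq)
  moreover have PI': "P x" if "x \<in> I'" for x using that PI by (auto simp: I'_def I)
  ultimately have "convex_on I' f"
    by (intro convex_onI) (use cf in \<open>auto\<close>)
  then have cont': "continuous_on I' f" by (rule convex_on_continuous[OF oI])
  show "continuous_on I f"
    unfolding continuous_on_eq_continuous_within
  proof
    fix x assume x: "x \<in> I"
    show "continuous (at x within I) f"
    proof (cases "x = 0")
      case False
      then have "x \<in> I'" using x by (auto simp: I I'_def)
      then show ?thesis using cont' oI continuous_on_eq_continuous_at continuous_at_imp_continuous_at_within by blast
    next
      case True
      obtain t where t: "0 < t" "P t" using above[OF x] by blast
      have "(f \<longlongrightarrow> 1) (at 0 within I)"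
      proof (rule tendsto_sandwich)
        have "eventually (\<lambda>y. y \<in> I \<and> y < t) (at 0 within I)"
          using t(1) by (auto simp: eventually_at intro!: exI[of _ t])
        then show "eventually (\<lambda>y. f y \<le> 1 + y / t * (f t - 1)) (at 0 within I)"
          by eventually_elim (use chord[OF _ _ t] in \<open>auto simp: I\<close>)
        show "eventually (\<lambda>y. 1 \<le> f y) (at 0 within I)"
          using f_ge by (auto simp: eventually_at intro!: exI[of _ 1])
        have "((\<lambda>y. 1 + y / t * (f t - 1)) \<longlongrightarrow> 1 + 0 / t * (f t - 1)) (at 0 within I)"
          using t by (intro tendsto_intros) auto
        then show "((\<lambda>y. 1 + y / t * (f t - 1)) \<longlongrightarrow> 1) (at 0 within I)" by simp
      qed simp
      then show ?thesis using True by (simp add: continuous_within f0)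
    qed
  qed
  show "\<exists>\<epsilon>\<in>I. r < f \<epsilon>" if ne: "I \<noteq> {}"
  proof (rule ccontr)
    assume "\<not> (\<exists>\<epsilon>\<in>I. r < f \<epsilon>)"
    then have r: "f x \<le> r" if "x \<in> I" for x using that by force
    obtain t where t: "0 < t" "P t" using above ne by blast
    have "ereal t \<le> b" unfolding b by (rule SUP_upper) (use t in simp)
    then consider "b = \<infinity>" | B where "b = ereal B" "0 < B" using t(1) by (cases b) auto
    then show False
    proof cases
      case 1
      define k where "k = \<bar>r\<bar> / (f t - 1) + 1"
      have ft: "1 < f t" by (rule gt1[OF t])
      then have k: "1 \<le> k" by (simp add: k_def)
      have kt: "k * t \<in> I" "P (k * t)" "0 < k * t" using 1 k t(1) PI by (auto simp: I)
      have "f t \<le> 1 + t / (k * t) * (f (k * t) - 1)"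
        using chord[of t "k * t"] t(1) k kt by simp
      then have "(f t - 1) * k \<le> f (k * t) - 1"
        using k t(1) by (simp add: field_simps)
      also have "\<dots> \<le> r - 1" using r[OF kt(1)] by simp
      finally have "(f t - 1) * k \<le> r - 1" .
      moreover have "(f t - 1) * k = \<bar>r\<bar> + (f t - 1)" using ft by (simp add: k_def distrib_left)
      ultimately show False using ft by linarith
    next
      case 2
      obtain p where p: "1 < p" "\<And>s. P s \<Longrightarrow> f s \<le> max r 1 \<Longrightarrow> P (p * s)"
        using self[of "max r 1"] by auto
      have "0 < B / p" "B / p < B" using 2 p by (auto simp: field_simps)
      then obtain s where s: "B / p < s" "s < B" "0 < s" using dense less_trans by metis
      then have sI: "s \<in> I" by (simp add: I 2)
      then have "P (p * s)" using p(2)[of s] PI r[OF sI] by auto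
      then have "ereal (p * s) \<le> b" unfolding b using p s by (intro SUP_upper) auto
      then show False using s(1) p 2 by (simp add: field_simps)
    qed
  qed
qed

theorem lemma3p1:
  fixes X :: "(real ^ 'n) set" and \<phi> :: "real ^ 'n \<Rightarrow> real"
    and F :: "real \<Rightarrow> ereal" and I :: "real set"
  assumes X: "X = UNIV \<or> cube X"
    and bmo: "\<phi> \<in> BMO X"
    and nonconst: "\<not> (\<exists>c. AE x in lebesgue. x \<in> X \<longrightarrow> \<phi> x = c)"
    and I: "I = {\<epsilon>. 0 \<le> \<epsilon> \<and> ereal \<epsilon> < critical_exponent X \<phi>}"
    and F: "\<And>\<epsilon>. F \<epsilon> = A_infty_char X (\<lambda>x. exp (\<epsilon> * \<phi> x))"
  shows "(\<forall>\<epsilon>\<in>I. (\<lambda>x. exp (\<epsilon> * \<phi> x)) \<in> A_infty X)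
    \<and> strict_mono_on I F
    \<and> continuous_on I F
    \<and> ((F \<circ> real_of_ereal) \<longlongrightarrow> \<infinity>) (at_left (critical_exponent X \<phi>))"
proof -
  define b where "b = critical_exponent X \<phi>"
  define D where "D = {(a :: real^'n, l). 0 < l \<and> cub a l \<subseteq> X}"
  define P where "P t \<longleftrightarrow> (\<lambda>x. exp (t * \<phi> x)) \<in> A_infty X" for t
  define r where "r t z = exp_ratio (\<lambda>x. t * \<phi> x) (fst z) (snd z)" for t z
  define f where "f t = real_of_ereal (F t)" for t
  have \<phi>: "\<phi> absolutely_integrable_on cub a l" if "0 < l" "cub a l \<subseteq> X" for a l
    using bmo that loc_integrable_iff[OF X] by (auto simp: BMO_def)
  have t\<phi>: "(\<lambda>x. t * \<phi> x) absolutely_integrable_on cub a l" if "0 < l" "cub a l \<subseteq> X" for a l t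
    by (rule abs_integrable_cmult[OF \<phi>[OF that]])
  have "D \<noteq> {}"
    using X unfolding D_def cube_iff by (metis (mono_tags, lifting) case_prodI empty_iff mem_Collect_eq order_refl subset_UNIV zero_less_one)
  then obtain z0 where z0: "z0 \<in> D" by blast
  have F_eq: "F t = (SUP z\<in>D. ereal (r t z))"
    if "\<And>a l. 0 < l \<Longrightarrow> cub a l \<subseteq> X \<Longrightarrow> (\<lambda>x. exp (t * \<phi> x)) absolutely_integrable_on cub a l" for t
    using A_infty_char_exp[of X "\<lambda>x. t * \<phi> x", OF t\<phi> that] by (simp add: F D_def r_def case_prod_beta')
  have P_iff: "P t \<longleftrightarrow> (\<forall>a l. 0 < l \<longrightarrow> cub a l \<subseteq> X \<longrightarrow>
      (\<lambda>x. exp (t * \<phi> x)) absolutely_integrable_on cub a l) \<and> F t < \<infinity>" for t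
    unfolding P_def A_infty_def using t\<phi>[of _ _ t] by (auto simp: loc_integrable_iff[OF X] F)
  have PI: "P t" "f t \<le> M"
    if "\<And>a l. 0 < l \<Longrightarrow> cub a l \<subseteq> X \<Longrightarrow> (\<lambda>x. exp (t * \<phi> x)) absolutely_integrable_on cub a l"
      and M: "\<And>z. z \<in> D \<Longrightarrow> r t z \<le> M" for t M
  proof -
    have eq: "F t = (SUP z\<in>D. ereal (r t z))" by (rule F_eq) (fact that(1))
    have "F t \<le> ereal M" unfolding eq by (rule SUP_least) (simp add: M)
    moreover have "ereal (r t z0) \<le> F t" unfolding eq by (rule SUP_upper[OF z0])
    ultimately obtain y where "F t = ereal y" "y \<le> M" by (cases "F t") auto
    then show "P t" "f t \<le> M" unfolding P_iff f_def using that(1) by auto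
  qed
  have Pint: "(\<lambda>x. exp (t * \<phi> x)) absolutely_integrable_on cub a l"
    if "P t" "0 < l" "cub a l \<subseteq> X" for t a l
    using that by (auto simp: P_iff)
  have F_real: "F t = ereal (f t)" and r_le: "\<And>z. z \<in> D \<Longrightarrow> r t z \<le> f t" if "P t" for t
  proof -
    have eq: "F t = (SUP z\<in>D. ereal (r t z))" by (rule F_eq) (fact Pint[OF that])
    have up: "ereal (r t z) \<le> F t" if "z \<in> D" for z
      unfolding eq by (rule SUP_upper[OF that])
    have "F t < \<infinity>" using that P_iff by blast
    then show *: "F t = ereal (f t)" using up[OF z0] by (cases "F t") (auto simp: f_def)
    show "r t z \<le> f t" if "z \<in> D" for z using up[OF that] * by simp
  qed
  have r1: "1 \<le> r t z" and r_const: "r t z \<le> 1 \<Longrightarrow>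
      AE x in lebesgue. x \<in> cub (fst z) (snd z) \<longrightarrow> t * \<phi> x = mean (\<lambda>x. t * \<phi> x) (fst z) (snd z)"
    if "P t" "z \<in> D" for t z
  proof -
    have z: "0 < snd z" "cub (fst z) (snd z) \<subseteq> X" using that(2) by (auto simp: D_def)
    note ge1 = exp_ratio_ge_1[OF z(1) t\<phi>[OF z] Pint[OF that(1) z]]
    show "1 \<le> r t z" unfolding r_def by (rule ge1(1))
    show "AE x in lebesgue. x \<in> cub (fst z) (snd z) \<longrightarrow> t * \<phi> x = mean (\<lambda>x. t * \<phi> x) (fst z) (snd z)"
      if "r t z \<le> 1" by (rule ge1(2)) (use that in \<open>simp add: r_def\<close>)
  qed
  have r0: "r 0 z = 1" if "z \<in> D" for z
    using that by (auto simp: r_def D_def exp_ratio_def mean_def integral_cub_const simp del: integral_const)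
  have P0: "P 0" by (rule PI(1)[where M = 1]) (auto simp: r0)
  have f0: "f 0 = 1"
  proof (rule antisym)
    show "f 0 \<le> 1" by (rule PI(2)) (auto simp: r0)
    show "1 \<le> f 0" using r_le[OF P0 z0] r0[OF z0] by simp
  qed
  have conv: "P (u * s + v * t)" "f (u * s + v * t) \<le> u * f s + v * f t"
    if "P s" "P t" "0 \<le> u" "0 \<le> v" "u + v = 1" for s t u v
  proof -
    have c1: "(\<lambda>x. exp ((u * s + v * t) * \<phi> x)) absolutely_integrable_on cub a l"
      if "0 < l" "cub a l \<subseteq> X" for a l
      by (rule exp_ratio_convex(1)) (use that \<phi> Pint \<open>P s\<close> \<open>P t\<close> \<open>0 \<le> u\<close> \<open>0 \<le> v\<close> \<open>u + v = 1\<close> in auto)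
    have c2: "r (u * s + v * t) z \<le> u * f s + v * f t" if "z \<in> D" for z
    proof -
      have z: "0 < snd z" "cub (fst z) (snd z) \<subseteq> X" using that by (auto simp: D_def)
      have "r (u * s + v * t) z \<le> u * r s z + v * r t z"
        unfolding r_def
        by (rule exp_ratio_convex(2)) (use z \<phi> Pint \<open>P s\<close> \<open>P t\<close> \<open>0 \<le> u\<close> \<open>0 \<le> v\<close> \<open>u + v = 1\<close> in auto)
      also have "\<dots> \<le> u * f s + v * f t"
        using r_le[OF \<open>P s\<close> \<open>z \<in> D\<close>] r_le[OF \<open>P t\<close> \<open>z \<in> D\<close>] \<open>0 \<le> u\<close> \<open>0 \<le> v\<close>
        by (intro add_mono mult_left_mono) auto
      finally show ?thesis .
    qed
    show "P (u * s + v * t)" by (rule PI(1)) (fact c1 c2)+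
    show "f (u * s + v * t) \<le> u * f s + v * f t" by (rule PI(2)) (fact c1 c2)+
  qed
  have gt1: "1 < f t" if t: "0 < t" "P t" for t
  proof (rule ccontr)
    assume "\<not> 1 < f t"
    then have "r t z \<le> 1" if "z \<in> D" for z using r_le[OF t(2) that] by linarith
    then have AE: "AE x in lebesgue. x \<in> cub a l \<longrightarrow> t * \<phi> x = mean (\<lambda>x. t * \<phi> x) a l"
      if "0 < l" "cub a l \<subseteq> X" for a l
      using r_const[OF t(2), of "(a, l)"] that by (simp add: D_def)
    have \<phi>_AE: "AE x in lebesgue. x \<in> cub a l \<longrightarrow> \<phi> x = mean (\<lambda>x. t * \<phi> x) a l / t"
      if "0 < l" "cub a l \<subseteq> X" for a l
      using AE[OF that] by eventually_elim (use t in \<open>auto simp: field_simps\<close>)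
    have "\<exists>k. AE x in lebesgue. x \<in> X \<longrightarrow> \<phi> x = k"
      by (rule AE_constant_if_cubs[OF X]) (fact \<phi>_AE)
    with nonconst show False by blast
  qed
  have self: "\<exists>p>1. \<forall>t. P t \<longrightarrow> f t \<le> M \<longrightarrow> P (p * t)" if M: "1 \<le> M" for M
  proof -
    obtain p C where p: "1 < p"
      "\<And>\<psi> a l. (\<And>b m. 0 < m \<Longrightarrow> cub b m \<subseteq> X \<Longrightarrow> \<psi> absolutely_integrable_on cub b m \<and>
          (\<lambda>x. exp (\<psi> x)) absolutely_integrable_on cub b m \<and> exp_ratio \<psi> b m \<le> M) \<Longrightarrow>
        0 < l \<Longrightarrow> cub a l \<subseteq> X \<Longrightarrow>
        (\<lambda>x. exp (p * \<psi> x)) absolutely_integrable_on cub a l \<and> exp_ratio (\<lambda>x. p * \<psi> x) a l \<le> C"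
      using exp_ratio_self_improvement[OF M, of X] by blast
    have "P (p * t)" if t: "P t" "f t \<le> M" for t
    proof -
      have "exp_ratio (\<lambda>x. t * \<phi> x) b m \<le> M" if "0 < m" "cub b m \<subseteq> X" for b m
        using r_le[OF t(1), of "(b, m)"] t(2) that by (simp add: D_def r_def)
      then have imp: "(\<lambda>x. exp (p * (t * \<phi> x))) absolutely_integrable_on cub a l \<and>
          exp_ratio (\<lambda>x. p * (t * \<phi> x)) a l \<le> C" if "0 < l" "cub a l \<subseteq> X" for a l
        by (intro p(2) that) (use t\<phi> Pint[OF t(1)] in auto)
      show ?thesis
        by (rule PI(1)[where M = C]) (use imp in \<open>auto simp: mult.assoc D_def r_def\<close>)
    qed
    then show ?thesis using p(1) by blast
  qed
  have b: "b = (SUP \<epsilon>\<in>{\<epsilon>. 0 < \<epsilon> \<and> P \<epsilon>}. ereal \<epsilon>)"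
    by (simp add: b_def critical_exponent_def P_def)
  have blowup: "\<forall>\<epsilon>\<in>I. P \<epsilon>" "strict_mono_on I f" "continuous_on I f" "I \<noteq> {} \<Longrightarrow> \<exists>\<epsilon>\<in>I. R < f \<epsilon>" for R
    using convex_family_blowup[where P = P and f = f, OF P0 f0 _ _ _ _ b I[folded b_def]]
      conv gt1 self by blast+
  have Feq: "F t = ereal (f t)" if "t \<in> I" for t using F_real blowup(1) that by blast
  have "strict_mono_on I F"
    using blowup(2) by (auto simp: strict_mono_on_def Feq)
  moreover have "continuous_on I F"
  proof -
    have "continuous_on I (\<lambda>t. ereal (f t))"
      by (intro continuous_intros blowup(3))
    then show ?thesis by (rule continuous_on_eq) (simp add: Feq)
  qed
  moreover have "((F \<circ> real_of_ereal) \<longlongrightarrow> \<infinity>) (at_left b)"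
  proof (cases "I = {}")
    case True
    have "b = -\<infinity>"
    proof (rule ccontr)
      assume "b \<noteq> -\<infinity>"
      then obtain t where t: "0 < t" "P t" unfolding b by (auto simp: bot_ereal_def[symmetric])
      have "ereal 0 < ereal t" using t(1) by simp
      also have "ereal t \<le> b" unfolding b by (rule SUP_upper) (use t in simp)
      finally show False using True I[folded b_def] by auto
    qed
    then show ?thesis by (simp add: trivial_limit_at_left_bot[where 'a = ereal, unfolded bot_ereal_def])
  next
    case False
    show ?thesis
      unfolding tendsto_PInfty
    proof
      fix R
      obtain e where e: "e \<in> I" "R < f e" using blowup(4)[OF False] by blast
      have "eventually (\<lambda>y. y \<in> {ereal e<..<b}) (at_left b)"
        by (rule eventually_at_leftI[of "ereal e"]) (use e(1) in \<open>auto simp: I b_def\<close>)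
      then show "eventually (\<lambda>y. ereal R < (F \<circ> real_of_ereal) y) (at_left b)"
      proof eventually_elim
        case (elim y)
        then obtain y' where y: "y = ereal y'" by (cases y) auto
        have y': "y' \<in> I" "e < y'" using elim e(1) by (auto simp: I[folded b_def] y)
        then have "f e < f y'" using blowup(2) e(1) by (simp add: strict_mono_on_def)
        then show ?case using e(2) Feq[OF y'(1)] by (simp add: y)
      qed
    qed
  qed
  ultimately show ?thesis using blowup(1) by (simp add: P_def b_def)
qed

end
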